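(* Let $G$ be a finitely generated virtually abelian group. Any finite generating set of $G$ is contained in a finite generating set $Z$ such that $(G,Z)$ has NSC and FFTP and $(G,Z)$ admits a geodesic prefix-closed biautomatic structure.
   Context: **Conventions.** $X\subseteq G$ is a generating set of $G$ if every element of $G$ is a product of elements of $X$ (generation as a monoid; $X$ need not be closed under inverses). Words in $X^*$ are identified with the elements they represent; $=_G$ is equality in $G$. $\ell(W)$ is the length of $W$; $|g|_X$ is the minimal length of a word over $X$ representing $g$; $d_X(g,h)=|g^{-1}h|_X$. A word $W$ is geodesic if $\ell(W)=|W|_X$, and a cyclic geodesic if all its cyclic shifts are geodesic. $\Gamma(G,X)$ is the Cayley graph, with an edge labelled $x$ from $g$ to $gx$. A path $p$ of length $n=\ell(p)$ runs through vertices $p(0),\dots,p(n)$, and $p(m)=p(n)$ for $m\ge n$. A path is geodesic if its label is. **Fellow traveling.** Paths $p,q$ asynchronously $K$-fellow travel if there are non-decreasing $\phi,\psi:\mathbb N\to\mathbb N$ with $d_X(p(t),q(\phi(t)))\le K$ and $d_X(p(\psi(t)),q(t))\le K$ for all $t$; synchronously if $d_X(p(t),q(t))\le K$ for all $t$. **FFTP.** $(G,X)$, $X$ finite, has FFTP (falsification by fellow traveler property) if there is $K\ge0$ such that for every non-geodesic path $p$ in $\Gamma(G,X)$ there is a path $q$ with the same endpoints, $\ell(q)<\ell(p)$, such that $p,q$ asynchronously $K$-fellow travel. **NSC.** $(G,X)$ has NSC (neighboring shorter conjugate property) if there is $B\ge0$ such that for every cyclic geodesic $U$ with $\ell(U)\ge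 B$ that is conjugate to some element of length less than $\ell(U)$, there are a cyclic permutation $U'$ of $U$ and $g\in G$ with $|g|_X\le B$ and $|gU'g^{-1}|_X<\ell(U)$. **Biautomatic structure.** A regular language $\mathcal L\subseteq X^*$ mapping onto $G$ is a biautomatic structure for $(G,X)$ if there is $M$ such that for all $W\in\mathcal L$, $x,y\in X\cup\{1\}$ and $U\in\mathcal L$ with $U=_G xWy$, the path labelled $W$ starting at $x$ and the path labelled $U$ starting at $1$ synchronously $M$-fellow travel. It is geodesic if every word of $\mathcal L$ is geodesic over $X$, and prefix-closed if every prefix of a word of $\mathcal L$ is in $\mathcal L$. *)

theory Defs
  imports "HOL-Algebra.Coset" "HOL-Library.Sublist"
begin

text \<open>
  A word over \<open>X\<close> is a list in \<open>lists X\<close>, where \<open>X\<close> is a set of elements of the group \<open>G\<close>.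
\<close>

definition word_prod :: "('a, 'b) monoid_scheme \<Rightarrow> 'a list \<Rightarrow> 'a" where
  "word_prod G W = foldr (\<otimes>\<^bsub>G\<^esub>) W \<one>\<^bsub>G\<^esub>"

text \<open>
  Generation is as a monoid: no inverses of elements of \<open>X\<close> are used.
\<close>

definition generating_set :: "('a, 'b) monoid_scheme \<Rightarrow> 'a set \<Rightarrow> bool" where
  "generating_set G X \<longleftrightarrow> X \<subseteq> carrier G \<and> carrier G \<subseteq> word_prod G ` lists X"

definition finitely_generated :: "('a, 'b) monoid_scheme \<Rightarrow> bool" where
  "finitely_generated G \<longleftrightarrow> (\<exists>X. finite X \<and> generating_set G X)"

definition virtually_abelian :: "('a, 'b) monoid_scheme \<Rightarrow> bool" where
  "virtually_abelian G \<longleftrightarrow>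
     (\<exists>H. subgroup H G \<and> comm_group (G\<lparr>carrier := H\<rparr>) \<and> finite (rcosets\<^bsub>G\<^esub> H))"

text \<open>
  The following length is meaningful only for elements represented by some word over \<open>X\<close>,
  i.e. for all of \<open>carrier G\<close> when \<open>X\<close> is a generating set.
\<close>

definition word_length :: "('a, 'b) monoid_scheme \<Rightarrow> 'a set \<Rightarrow> 'a \<Rightarrow> nat" where
  "word_length G X g = (LEAST n. \<exists>W \<in> lists X. length W = n \<and> word_prod G W = g)"

definition word_dist :: "('a, 'b) monoid_scheme \<Rightarrow> 'a set \<Rightarrow> 'a \<Rightarrow> 'a \<Rightarrow> nat" where
  "word_dist G X g h = word_length G X (inv\<^bsub>G\<^esub> g \<otimes>\<^bsub>G\<^esub> h)"

definition geodesic_word :: "('a, 'b) monoid_scheme \<Rightarrow> 'a set \<Rightarrow> 'a list \<Rightarrow> bool" where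
  "geodesic_word G X W \<longleftrightarrow> W \<in> lists X \<and> length W = word_length G X (word_prod G W)"

definition cyclic_geodesic :: "('a, 'b) monoid_scheme \<Rightarrow> 'a set \<Rightarrow> 'a list \<Rightarrow> bool" where
  "cyclic_geodesic G X W \<longleftrightarrow> (\<forall>n. geodesic_word G X (rotate n W))"

text \<open>
  A path in the Cayley graph is given by its initial vertex and its label. As
  \<open>take t W = W\<close> for \<open>t \<ge> length W\<close>, a path stays at its final vertex from time
  \<open>length W\<close> on.
\<close>

definition cayley_paths :: "('a, 'b) monoid_scheme \<Rightarrow> 'a set \<Rightarrow> ('a \<times> 'a list) set" where
  "cayley_paths G X = carrier G \<times> lists X"

definition vertex_at :: "('a, 'b) monoid_scheme \<Rightarrow> 'a \<times> 'a list \<Rightarrow> nat \<Rightarrow> 'a" where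
  "vertex_at G p t = fst p \<otimes>\<^bsub>G\<^esub> word_prod G (take t (snd p))"

definition path_length :: "'a \<times> 'a list \<Rightarrow> nat" where
  "path_length p = length (snd p)"

definition geodesic_path :: "('a, 'b) monoid_scheme \<Rightarrow> 'a set \<Rightarrow> 'a \<times> 'a list \<Rightarrow> bool" where
  "geodesic_path G X p \<longleftrightarrow> geodesic_word G X (snd p)"

definition same_endpoints ::
    "('a, 'b) monoid_scheme \<Rightarrow> 'a \<times> 'a list \<Rightarrow> 'a \<times> 'a list \<Rightarrow> bool" where
  "same_endpoints G p q \<longleftrightarrow>
     vertex_at G p 0 = vertex_at G q 0 \<and>
     vertex_at G p (path_length p) = vertex_at G q (path_length q)"

definition sync_fellow_travel ::
    "('a, 'b) monoid_scheme \<Rightarrow> 'a set \<Rightarrow> nat \<Rightarrow> 'a \<times> 'a list \<Rightarrow> 'a \<times> 'a list \<Rightarrow> bool" where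
  "sync_fellow_travel G X K p q \<longleftrightarrow>
     (\<forall>t. word_dist G X (vertex_at G p t) (vertex_at G q t) \<le> K)"

definition async_fellow_travel ::
    "('a, 'b) monoid_scheme \<Rightarrow> 'a set \<Rightarrow> nat \<Rightarrow> 'a \<times> 'a list \<Rightarrow> 'a \<times> 'a list \<Rightarrow> bool" where
  "async_fellow_travel G X K p q \<longleftrightarrow>
     (\<exists>\<phi> \<psi> :: nat \<Rightarrow> nat. mono \<phi> \<and> mono \<psi> \<and>
        (\<forall>t. word_dist G X (vertex_at G p t) (vertex_at G q (\<phi> t)) \<le> K \<and>
             word_dist G X (vertex_at G p (\<psi> t)) (vertex_at G q t) \<le> K))"

definition FFTP :: "('a, 'b) monoid_scheme \<Rightarrow> 'a set \<Rightarrow> bool" where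
  "FFTP G X \<longleftrightarrow> finite X \<and>
     (\<exists>K. \<forall>p \<in> cayley_paths G X. \<not> geodesic_path G X p \<longrightarrow>
        (\<exists>q \<in> cayley_paths G X. same_endpoints G p q \<and> path_length q < path_length p \<and>
           async_fellow_travel G X K p q))"

definition NSC :: "('a, 'b) monoid_scheme \<Rightarrow> 'a set \<Rightarrow> bool" where
  "NSC G X \<longleftrightarrow>
     (\<exists>B. \<forall>U. cyclic_geodesic G X U \<and> B \<le> length U \<and>
        (\<exists>h \<in> carrier G.
           word_length G X (h \<otimes>\<^bsub>G\<^esub> word_prod G U \<otimes>\<^bsub>G\<^esub> inv\<^bsub>G\<^esub> h) < length U) \<longrightarrow>
        (\<exists>n. \<exists>g \<in> carrier G. word_length G X g \<le> B \<and>
           word_length G X (g \<otimes>\<^bsub>G\<^esub> word_prod G (rotate n U) \<otimes>\<^bsub>G\<^esub> inv\<^bsub>G\<^esub> g) < length U))"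

text \<open>
  A language is regular if it is accepted by a deterministic finite automaton; without loss
  of generality the states are natural numbers.
\<close>

definition regular_language :: "'a set \<Rightarrow> 'a list set \<Rightarrow> bool" where
  "regular_language X L \<longleftrightarrow>
     (\<exists>(Q :: nat set) \<delta> q0 F. finite Q \<and> q0 \<in> Q \<and> F \<subseteq> Q \<and>
        (\<forall>q \<in> Q. \<forall>x \<in> X. \<delta> q x \<in> Q) \<and>
        L = {W \<in> lists X. foldl \<delta> q0 W \<in> F})"

definition biautomatic_structure :: "('a, 'b) monoid_scheme \<Rightarrow> 'a set \<Rightarrow> 'a list set \<Rightarrow> bool" where
  "biautomatic_structure G X L \<longleftrightarrow>
     regular_language X L \<and> word_prod G ` L = carrier G \<and>
     (\<exists>M. \<forall>W \<in> L. \<forall>U \<in> L. \<forall>x \<in> X \<union> {\<one>\<^bsub>G\<^esub>}. \<forall>y \<in> X \<union> {\<one>\<^bsub>G\<^esub>}.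
        word_prod G U = x \<otimes>\<^bsub>G\<^esub> word_prod G W \<otimes>\<^bsub>G\<^esub> y \<longrightarrow>
        sync_fellow_travel G X M (x, W) (\<one>\<^bsub>G\<^esub>, U))"

definition geodesic_language :: "('a, 'b) monoid_scheme \<Rightarrow> 'a set \<Rightarrow> 'a list set \<Rightarrow> bool" where
  "geodesic_language G X L \<longleftrightarrow> (\<forall>W \<in> L. geodesic_word G X W)"

definition prefix_closed :: "'a list set \<Rightarrow> bool" where
  "prefix_closed L \<longleftrightarrow> (\<forall>W \<in> L. \<forall>V. prefix V W \<longrightarrow> V \<in> L)"

end

theory Submission
  imports Defs Complex_Main "HOL-Library.Multiset_Order"
begin

text \<open>
  Let \<open>N\<close> be an abelian normal subgroup of finite index \<open>m\<close>. The generating set is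
  \<open>Z = A \<union> B\<close>, where \<open>B = X - N\<close> and \<open>A \<subseteq> N\<close> is finite and invariant under conjugation
  by \<open>G\<close>. As \<open>A\<close> is invariant, the letters of a word that lie in \<open>A\<close> can be pushed to its
  right end: they get conjugated, the length does not change, and the word becomes
  \<open>\<tau> @ v\<close> with \<open>\<tau>\<close> over \<open>B\<close> and \<open>v\<close> over \<open>A\<close>, where only the multiset of the letters of
  \<open>v\<close> matters. By the pigeonhole principle a word \<open>\<tau>\<close> of length at least \<open>m\<close> contains a
  nonempty subword of length at most \<open>m\<close> with value in \<open>N\<close>. Its length is at least two, since
  the letters in \<open>B\<close> are outside \<open>N\<close>, and its value is a single letter in \<open>A\<close>. So \<open>\<tau>\<close> is shorter than \<open>m\<close> in every geodesic, and a geodesic amounts to one of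
  finitely many words \<open>\<tau>\<close> together with a multiset over the finite set \<open>A\<close>.

  For fixed \<open>\<tau>\<close>, both "\<open>\<tau> @ v\<close> is not geodesic" and "\<open>\<tau> @ v\<close> has a conjugate that is shorter
  than it" are preserved when letters of \<open>A\<close> are added. By Dickson's lemma there is a constant
  \<open>c\<close> such that such a property of a multiset holds already for its truncation, in which
  every multiplicity above \<open>c\<close> is cut down to \<open>c\<close>
  (\<open>upward_closed_detected_by_truncation\<close>). Hence finitely many conjugators suffice for NSC
  (\<open>NSC_Z\<close>), and a path that is not geodesic is shortened by replacing boundedly many of its
  letters, which gives FFTP (\<open>FFTP_Z\<close>).

  Biautomaticity needs a normal form that conjugation by \<open>G\<close> respects up to bounded error,
  so the letters of \<open>A\<close> must not be ordered arbitrarily. Therefore \<open>A\<close> consists of the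
  products of all nonempty subsets of a finite invariant set \<open>Y \<subseteq> N\<close>, and the size of a
  letter is the largest cardinality of a subset of \<open>Y\<close> with this product. Words of equal
  length are compared by the multiset of the sizes of their letters, larger sizes being
  preferred; a word is optimal if no word with the same value is shorter or preferred to it.
  Subsets \<open>S \<noteq> T\<close> of equal cardinality can be replaced by \<open>S \<union> T\<close> and \<open>S \<inter> T\<close>, which have
  the same total product and are preferred. So two letters of \<open>A\<close> of the same size that
  occur in one optimal word are equal (\<open>minimal_inj_sz\<close>), and listing the letters by decreasing size orders them in
  an invariant way. Let \<open>\<L>\<close> be the language of the optimal words whose letters occur by
  decreasing size. Dickson's lemma makes it regular (\<open>\<L>_regular\<close>).

  It remains to see that if the values of two optimal multisets over \<open>A\<close> differ by a fixed
  \<open>\<delta> \<in> N\<close>, then the multisets differ in boundedly many letters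
  (\<open>minimal_discrepancy_bounded\<close>). Otherwise there is a sequence of such pairs with unbounded
  difference, and by Dickson's lemma we may assume that both components increase. Let \<open>V\<close> and
  \<open>V'\<close> be the increments from the \<open>j\<close>-th to the \<open>k\<close>-th pair. They have equal values and are
  optimal, so they have the same numbers of letters of each size, and \<open>V\<close> can be exchanged
  for \<open>V'\<close> in any optimal multiset without losing optimality. For large \<open>j\<close>, all letters of
  \<open>V\<close> occur already in the increment from the first to the \<open>j\<close>-th pair; as an optimal multiset
  has only one letter of each size, this forces \<open>V = V'\<close>
  (\<open>minimal_increment_unique\<close>). But then the difference is the same for all \<open>k\<close>, a
  contradiction. Finally, sorted words whose multisets are close have close prefixes
  (\<open>count_take_sorted\<close>), so they fellow travel synchronously (\<open>\<L>_biautomatic\<close>).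
\<close>

section \<open>Dickson's lemma for multisets\<close>

lemma nat_seq_mono_subseq:
  fixes s :: "nat \<Rightarrow> nat"
  obtains r :: "nat \<Rightarrow> nat" where "strict_mono r" "mono (\<lambda>i. s (r i))"
proof -
  obtain f :: "nat \<Rightarrow> nat" where f: "strict_mono f" "monoseq (\<lambda>n. s (f n))"
    using seq_monosub by blast
  show thesis
  proof (cases "mono (\<lambda>n. s (f n))")
    case True
    with f(1) that show thesis by blast
  next
    case False
    with f(2) have dec: "antimono (\<lambda>n. s (f n))"
      by (auto simp: monoseq_iff)
    obtain k where k: "\<And>i. s (f k) \<le> s (f i)"
      using ex_has_least_nat[of "\<lambda>_. True" _ "\<lambda>i. s (f i)"] by blast
    have "s (f (k + i)) = s (f k)" for i
      using k[of "k + i"] antimonoD[OF dec, of k "k + i"] by simp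
    then have "mono (\<lambda>i. s (f (k + i)))" by (simp add: mono_def)
    moreover have "strict_mono (\<lambda>i. f (k + i))"
      using f(1) by (simp add: strict_mono_def)
    ultimately show thesis using that by blast
  qed
qed

text \<open>
  The coordinates in \<open>S\<close> are treated one after the other: a subsequence of a sequence that is
  nondecreasing in some coordinates remains so.
\<close>

lemma dickson_subseq:
  fixes f :: "nat \<Rightarrow> 'c \<Rightarrow> nat"
  assumes "finite S"
  shows "\<exists>r :: nat \<Rightarrow> nat. strict_mono r \<and> (\<forall>a\<in>S. mono (\<lambda>i. f (r i) a))"
  using assms
proof (induction S rule: finite_induct)
  case empty
  show ?case by (rule exI[of _ id]) (simp add: strict_mono_def)
next
  case (insert x S)
  then obtain r :: "nat \<Rightarrow> nat" where r: "strict_mono r" "\<forall>a\<in>S. mono (\<lambda>i. f (r i) a)" by blast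
  obtain q :: "nat \<Rightarrow> nat" where q: "strict_mono q" "mono (\<lambda>i. f (r (q i)) x)"
    using nat_seq_mono_subseq[of "\<lambda>i. f (r i) x"] by blast
  have "strict_mono (\<lambda>i. r (q i))"
    using r(1) q(1) by (simp add: strict_mono_def)
  moreover have "mono (\<lambda>i. f (r (q i)) a)" if "a \<in> S" for a
    using r(2) that strict_mono_mono[OF q(1)] by (auto simp: mono_def)
  ultimately show ?case using q(2) by (intro exI[of _ "\<lambda>i. r (q i)"]) auto
qed

definition truncate :: "nat \<Rightarrow> 'c set \<Rightarrow> 'c multiset \<Rightarrow> 'c multiset" where
  "truncate c A M = M \<inter># repeat_mset c (mset_set A)"

lemma truncate_subset: "truncate c A M \<subseteq># M"
  by (simp add: truncate_def)

lemma count_truncate: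
  "finite A \<Longrightarrow> count (truncate c A M) a = (if a \<in> A then min (count M a) c else 0)"
  by (simp add: truncate_def count_mset_set')

lemma truncate_mono: "c \<le> d \<Longrightarrow> truncate c A M \<subseteq># truncate d A M"
  by (auto simp: subseteq_mset_def truncate_def min_le_iff_disj intro: mult_le_mono1)

lemma finite_submultisets: "finite {V. V \<subseteq># M}"
proof (induction M)
  case (add x M)
  have "{V. V \<subseteq># add_mset x M} \<subseteq> {V. V \<subseteq># M} \<union> add_mset x ` {V. V \<subseteq># M}"
  proof
    fix V assume V: "V \<in> {V. V \<subseteq># add_mset x M}"
    show "V \<in> {V. V \<subseteq># M} \<union> add_mset x ` {V. V \<subseteq># M}"
    proof (cases "x \<in># V")
      case True
      then obtain V' where "V = add_mset x V'" by (blast dest: multi_member_split)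
      with V show ?thesis by auto
    next
      case False
      have "count V y \<le> count M y" for y
        using V False mset_subset_eq_count[of V "add_mset x M" y]
        by (cases "y = x") (simp_all add: not_in_iff)
      then have "V \<subseteq># M" by (simp add: subseteq_mset_def)
      then show ?thesis by simp
    qed
  qed
  then show ?case using add by (meson finite_UnI finite_imageI finite_subset)
qed simp

lemma finite_truncations: "finite (range (truncate c A))"
  by (rule finite_subset[OF _ finite_submultisets[of "repeat_mset c (mset_set A)"]])
     (auto simp: truncate_def)

text \<open>
  If truncation at \<open>c\<close> lost the property \<open>P\<close> for every \<open>c\<close>, there would be counterexamples
  \<open>F c\<close>. Along a subsequence of these that is nondecreasing on \<open>A\<close>, its first member is
  contained in a truncation of a later one, which has \<open>P\<close> since \<open>P\<close> is upward closed.
\<close>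

lemma upward_closed_detected_by_truncation:
  fixes P :: "'d \<Rightarrow> 'c multiset \<Rightarrow> bool"
  assumes "finite T" "finite A"
    and up: "\<And>t M M'. \<lbrakk>t \<in> T; P t M; M \<subseteq># M'; set_mset M' \<subseteq> A\<rbrakk> \<Longrightarrow> P t M'"
  shows "\<exists>c. \<forall>t\<in>T. \<forall>M. set_mset M \<subseteq> A \<longrightarrow> P t M \<longrightarrow> P t (truncate c A M)"
proof -
  have sub: "set_mset (truncate c A M) \<subseteq> A" for c M
    using count_truncate[OF assms(2), of c M] by (auto simp flip: count_greater_zero_iff split: if_splits)
  have single: "\<exists>c. \<forall>M. set_mset M \<subseteq> A \<longrightarrow> P t M \<longrightarrow> P t (truncate c A M)" if t: "t \<in> T" for t
  proof (rule ccontr)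
    assume "\<not> ?thesis"
    then have "\<forall>c. \<exists>M. set_mset M \<subseteq> A \<and> P t M \<and> \<not> P t (truncate c A M)" by blast
    then obtain F where F: "\<And>c. set_mset (F c) \<subseteq> A" "\<And>c. P t (F c)"
      "\<And>c. \<not> P t (truncate c A (F c))"
      by metis
    obtain r :: "nat \<Rightarrow> nat" where r: "strict_mono r" "\<forall>a\<in>A. mono (\<lambda>i. count (F (r i)) a)"
      using dickson_subseq[OF assms(2), of "\<lambda>i. count (F i)"] by blast
    \<comment> \<open>The size bounds all multiplicities in \<open>F (r 0)\<close>, so truncating at \<open>r j \<ge> j\<close> keeps them.\<close>
    define j where "j = size (F (r 0))"
    have "F (r 0) \<subseteq># truncate (r j) A (F (r j))"
    proof (rule mset_subset_eqI)
      fix a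
      show "count (F (r 0)) a \<le> count (truncate (r j) A (F (r j))) a"
      proof (cases "a \<in> A")
        case True
        have "count (F (r 0)) a \<le> j" unfolding j_def by (rule count_le_size)
        also have "j \<le> r j" using r(1) by (rule strict_mono_imp_increasing)
        finally show ?thesis
          using True r(2) assms(2) by (auto simp: count_truncate mono_def)
      next
        case False
        then have "a \<notin># F (r 0)" using F(1) by blast
        then show ?thesis by (simp add: not_in_iff)
      qed
    qed
    then have "P t (truncate (r j) A (F (r j)))" by (rule up[OF t F(2) _ sub])
    with F(3) show False by blast
  qed
  then obtain c where c: "\<And>t M. \<lbrakk>t \<in> T; set_mset M \<subseteq> A; P t M\<rbrakk> \<Longrightarrow> P t (truncate (c t) A M)"
    by metis
  show ?thesis
  proof (intro exI[of _ "Max (insert 0 (c ` T))"] ballI allI impI)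
    fix t M assume *: "t \<in> T" "set_mset M \<subseteq> A" "P t M"
    have "c t \<le> Max (insert 0 (c ` T))" using *(1) assms(1) by auto
    then show "P t (truncate (Max (insert 0 (c ` T))) A M)"
      using up[OF *(1) c[OF *] truncate_mono sub] by blast
  qed
qed

section \<open>Comparing words by length and letter sizes\<close>

text \<open>
  The multiset order on \<open>nat multiset\<close> compares the multiplicities of the largest number on
  which two multisets differ. It is linear and compatible with addition, so comparing costs in
  this order does not depend on a common context of the words.
\<close>

definition better :: "nat multiset \<Rightarrow> nat multiset \<Rightarrow> bool" where
  "better C D \<longleftrightarrow> size C < size D \<or> size C = size D \<and> D < C"

lemma better_add: "better (C + E) (D + E) \<longleftrightarrow> better C D"
  by (auto simp: better_def)

lemma better_total: "\<not> better C D \<Longrightarrow> \<not> better D C \<Longrightarrow> C = D"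
  by (auto simp: better_def)

lemma better_pair:
  assumes "s < p" shows "better {#p, q#} {#s, s#}"
proof -
  have "{#s, s#} < {#p, q#}"
    using assms by (intro ex_gt_imp_less_multiset) (auto intro!: exI[of _ p])
  then show ?thesis by (simp add: better_def)
qed

text \<open>
  Only finitely many words have minimal length, so one of them has the largest multiset of
  sizes.
\<close>

lemma best_word_exists:
  fixes sz :: "'a \<Rightarrow> nat"
  assumes "finite Z" "w \<in> lists Z" "P w"
  shows "\<exists>v\<in>lists Z. P v \<and>
    (\<forall>u\<in>lists Z. P u \<longrightarrow> \<not> better (image_mset sz (mset u)) (image_mset sz (mset v)))"
proof -
  obtain v0 where v0: "v0 \<in> lists Z \<and> P v0"
    and least: "\<And>u. u \<in> lists Z \<and> P u \<Longrightarrow> length v0 \<le> length u"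
    using ex_has_least_nat[of "\<lambda>v. v \<in> lists Z \<and> P v" w length] assms(2,3) by auto
  define n where "n = length v0"
  define S where "S = {v \<in> lists Z. P v \<and> length v = n}"
  have ne: "S \<noteq> {}" using v0 by (auto simp: S_def n_def)
  have "finite S"
    by (rule finite_subset[OF _ finite_lists_length_eq[OF assms(1), of n]]) (auto simp: S_def)
  then have fin: "finite ((\<lambda>v. image_mset sz (mset v)) ` S)" by simp
  obtain v where v: "v \<in> S" "image_mset sz (mset v) = Max ((\<lambda>v. image_mset sz (mset v)) ` S)"
    using Max_in[OF fin] ne by (metis (no_types, lifting) image_iff image_is_empty)
  have "\<not> better (image_mset sz (mset u)) (image_mset sz (mset v))" if u: "u \<in> lists Z" "P u" for u
  proof
    assume b: "better (image_mset sz (mset u)) (image_mset sz (mset v))"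
    have "length v = n" using v(1) by (simp add: S_def)
    then have "u \<in> S" "image_mset sz (mset v) < image_mset sz (mset u)"
      using b least[of u] u by (auto simp: better_def S_def n_def)
    then show False using Max_ge[OF fin, of "image_mset sz (mset u)"] v(2) by (auto simp: leD)
  qed
  then show ?thesis using v(1) by (auto simp: S_def)
qed

section \<open>Prefixes of sorted words\<close>

text \<open>
  The copies of \<open>a\<close> in \<open>w\<close> form one block, which comes after exactly the letters of larger
  size. Consequently the letters of a prefix depend in a Lipschitz way on the multiset of
  the letters of \<open>w\<close>.
\<close>

lemma count_take_sorted:
  fixes sz :: "'a \<Rightarrow> nat"
  assumes "sorted_wrt (\<lambda>x y. sz y \<le> sz x) w" "inj_on sz (set w)" "a \<in> set w"
  shows "count (mset (take t w)) a =
    min (count (mset w) a) (t - size (filter_mset (\<lambda>b. sz a < sz b) (mset w)))"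
  using assms
proof (induction w arbitrary: t)
  case (Cons b w)
  show ?case
  proof (cases t)
    case (Suc s)
    show ?thesis
    proof (cases "b = a")
      case True
      then have none: "filter_mset (\<lambda>c. sz a < sz c) (mset w) = {#}"
        using Cons.prems(1) by (auto simp: filter_mset_False not_less)
      show ?thesis
      proof (cases "a \<in> set w")
        case True
        then show ?thesis
          using Cons.IH[of s] Cons.prems none \<open>b = a\<close> Suc
          by (simp del: filter_mset_eq_mempty_iff add: inj_on_insert)
      next
        case False
        then have "a \<notin> set (take s w)" by (meson in_set_takeD)
        with False show ?thesis
          using none \<open>b = a\<close> Suc
          by (simp del: filter_mset_eq_mempty_iff add: count_mset_0_iff[THEN iffD2])
      qed
    next
      case False
      with Cons.prems have "a \<in> set w" "sz a < sz b"
        by (auto simp: inj_on_def order_less_le)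
      then show ?thesis using Cons.IH[of s] Cons.prems False Suc by (simp add: inj_on_insert)
    qed
  qed simp
qed simp

section \<open>Deleting letters from a word\<close>

text \<open>
  This deletes the first occurrences of the letters in \<open>V\<close>. Deleting the first occurrences,
  rather than arbitrary ones, makes the operation compatible with prefixes.
\<close>

primrec delete_letters :: "'c multiset \<Rightarrow> 'c list \<Rightarrow> 'c list" where
  "delete_letters V [] = []"
| "delete_letters V (a # l) =
    (if a \<in># V then delete_letters (V - {#a#}) l else a # delete_letters V l)"

lemma mset_delete_letters: "mset (delete_letters V l) = mset l - V"
proof (induction l arbitrary: V)
  case (Cons a l)
  show ?case
  proof (cases "a \<in># V")
    case True
    then obtain V' where "V = add_mset a V'" by (blast dest: multi_member_split)
    then show ?thesis using Cons by simp
  next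
    case False
    then have "add_mset a (mset l) - V = add_mset a (mset l - V)"
      by (intro multiset_eqI) (simp add: not_in_iff)
    then show ?thesis using Cons False by simp
  qed
qed simp

lemma delete_letters_append:
  "delete_letters V (k @ l) = delete_letters V k @ delete_letters (V - mset k) l"
proof (induction k arbitrary: V)
  case (Cons a k)
  show ?case
  proof (cases "a \<in># V")
    case False
    then have "V - add_mset a (mset k) = V - mset k"
      by (intro multiset_eqI) (simp add: not_in_iff)
    then show ?thesis using Cons False by simp
  qed (use Cons in simp)
qed simp

lemma set_delete_letters: "set (delete_letters V l) \<subseteq> set l"
  using mset_delete_letters[of V l] by (metis in_diffD set_mset_mset subsetI)

lemma length_delete_letters_take:
  "length (delete_letters V (take k l)) \<le> length (delete_letters V (take (Suc k) l))"
  "length (delete_letters V (take (Suc k) l)) \<le> Suc (length (delete_letters V (take k l)))"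
  by (cases "k < length l"; simp add: take_Suc_conv_app_nth delete_letters_append)+

section \<open>Regularity from finitely many residuals\<close>

lemma finite_image_if_factors:
  assumes "finite (f ` S)" and "\<And>a b. \<lbrakk>a \<in> S; b \<in> S; f a = f b\<rbrakk> \<Longrightarrow> h a = h b"
  shows "finite (h ` S)"
proof (rule finite_subset)
  show "h ` S \<subseteq> (\<lambda>y. h (SOME a. a \<in> S \<and> f a = y)) ` f ` S"
  proof (rule image_subsetI)
    fix a assume a: "a \<in> S"
    define b where "b = (SOME b. b \<in> S \<and> f b = f a)"
    have "b \<in> S \<and> f b = f a" unfolding b_def by (rule someI[of _ a]) (use a in simp)
    then have "h a = h b" using assms(2) a by metis
    then show "h a \<in> (\<lambda>y. h (SOME a. a \<in> S \<and> f a = y)) ` f ` S"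
      using a unfolding b_def by blast
  qed
qed (use assms(1) in simp)

text \<open>
  This is the Myhill-Nerode criterion. The function \<open>f\<close> records enough of a word to determine
  its residual, so there are finitely many residuals; their numbers are the states.
\<close>

lemma regular_language_if_finite_congruence:
  assumes "L \<subseteq> lists X" and fin: "finite (f ` lists X)"
    and congruent: "\<And>u u' v. \<lbrakk>u \<in> lists X; u' \<in> lists X; f u = f u'; v \<in> lists X; u @ v \<in> L\<rbrakk>
      \<Longrightarrow> u' @ v \<in> L"
  shows "regular_language X L"
proof -
  define res where "res u = {v \<in> lists X. u @ v \<in> L}" for u
  have finR: "finite (res ` lists X)"
  proof (rule finite_image_if_factors[OF fin])
    fix u u' assume "u \<in> lists X" "u' \<in> lists X" "f u = f u'"
    then show "res u = res u'"
      using congruent[of u u'] congruent[of u' u] unfolding res_def by auto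
  qed
  then obtain e :: "'a list set \<Rightarrow> nat" where e: "inj_on e (res ` lists X)"
    using finite_imp_inj_to_nat_seg by blast
  define dec where "dec = the_inv_into (res ` lists X) e"
  have dec: "dec (e (res u)) = res u" if "u \<in> lists X" for u
    unfolding dec_def using e that by (simp add: the_inv_into_f_f)
  define step where "step q x = e {v \<in> lists X. x # v \<in> dec q}" for q x
  have step: "step (e (res u)) x = e (res (u @ [x]))" if "u \<in> lists X" "x \<in> X" for u x
    using that by (simp add: step_def dec) (simp add: res_def)
  have run: "foldl step (e (res u)) v = e (res (u @ v))" if "u \<in> lists X" "v \<in> lists X" for u v
    using that(2,1)
  proof (induction v arbitrary: u)
    case (Cons x v)
    then show ?case using Cons.IH[of "u @ [x]"] by (simp add: step)
  qed simp
  have "W \<in> L \<longleftrightarrow> foldl step (e (res [])) W \<in> e ` {R \<in> res ` lists X. [] \<in> R}"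
    if W: "W \<in> lists X" for W
  proof -
    have "foldl step (e (res [])) W = e (res W)" using run[of "[]" W] W by simp
    moreover have "e (res W) \<in> e ` {R \<in> res ` lists X. [] \<in> R} \<longleftrightarrow> [] \<in> res W"
      using inj_on_image_mem_iff[OF e, of "res W" "{R \<in> res ` lists X. [] \<in> R}"] W by auto
    moreover have "[] \<in> res W \<longleftrightarrow> W \<in> L" by (simp add: res_def)
    ultimately show ?thesis by simp
  qed
  then have "L = {W \<in> lists X. foldl step (e (res [])) W \<in> e ` {R \<in> res ` lists X. [] \<in> R}}"
    using assms(1) by blast
  moreover have "\<forall>q\<in>e ` res ` lists X. \<forall>x\<in>X. step q x \<in> e ` res ` lists X"
    using step by fastforce
  ultimately show ?thesis
    unfolding regular_language_def using finR
    by (intro exI[of _ "e ` res ` lists X"] exI[of _ step] exI[of _ "e (res [])"]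
        exI[of _ "e ` {R \<in> res ` lists X. [] \<in> R}"]) auto
qed

section \<open>Fellow travelling\<close>

text \<open>
  As \<open>\<phi>\<close> moves by steps of at most one, it takes every value from \<open>\<phi> 0\<close> on, so a
  reparametrisation \<open>\<psi>\<close> in the other direction is the least preimage. The part of \<open>q\<close> before
  time \<open>\<phi> 0\<close> is matched with the start of \<open>p\<close>.
\<close>

lemma async_fellow_travel_if_reparametrised:
  fixes \<phi> :: "nat \<Rightarrow> nat"
  assumes "mono \<phi>" and slow: "\<And>t. \<phi> (Suc t) \<le> Suc (\<phi> t)" and unbounded: "\<And>n. \<exists>t. n \<le> \<phi> t"
    and follow: "\<And>t. word_dist G X (vertex_at G p t) (vertex_at G q (\<phi> t)) \<le> K"
    and start: "\<And>t. t \<le> \<phi> 0 \<Longrightarrow> word_dist G X (vertex_at G p 0) (vertex_at G q t) \<le> K"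
  shows "async_fellow_travel G X K p q"
proof -
  define \<psi> where "\<psi> n = (LEAST t. n \<le> \<phi> t)" for n
  have ge: "n \<le> \<phi> (\<psi> n)" for n
    unfolding \<psi>_def using unbounded by (rule LeastI_ex)
  have mono: "mono \<psi>"
  proof (rule monoI)
    fix x y :: nat assume "x \<le> y"
    then have "x \<le> \<phi> (\<psi> y)" using ge[of y] by simp
    then show "\<psi> x \<le> \<psi> y" unfolding \<psi>_def[of x] by (rule Least_le)
  qed
  have "word_dist G X (vertex_at G p (\<psi> n)) (vertex_at G q n) \<le> K" for n
  proof (cases "\<psi> n")
    case 0
    then show ?thesis using start ge[of n] by simp
  next
    case (Suc t)
    then have "\<not> n \<le> \<phi> t"
      using not_less_Least[of t "\<lambda>t. n \<le> \<phi> t"] by (simp add: \<psi>_def)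
    then have "\<phi> (\<psi> n) = n" using ge[of n] slow[of t] Suc by simp
    then show ?thesis using follow[of "\<psi> n"] by simp
  qed
  then show ?thesis
    unfolding async_fellow_travel_def using assms(1) mono follow by blast
qed

section \<open>Words in a group\<close>

context group
begin

abbreviation "wp \<equiv> word_prod G"

lemma wp_Nil [simp]: "wp [] = \<one>"
  and wp_Cons [simp]: "wp (x # w) = x \<otimes> wp w"
  by (simp_all add: word_prod_def)

lemma wp_closed [simp]: "set w \<subseteq> carrier G \<Longrightarrow> wp w \<in> carrier G"
  by (induction w) auto

lemma wp_append:
  "set u \<subseteq> carrier G \<Longrightarrow> set v \<subseteq> carrier G \<Longrightarrow> wp (u @ v) = wp u \<otimes> wp v"
  by (induction u) (auto simp: m_assoc)

definition conj_by :: "'a \<Rightarrow> 'a \<Rightarrow> 'a" where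
  "conj_by g x = inv g \<otimes> x \<otimes> g"

lemma conj_by_closed [simp]: "g \<in> carrier G \<Longrightarrow> x \<in> carrier G \<Longrightarrow> conj_by g x \<in> carrier G"
  by (simp add: conj_by_def)

lemma conj_by_mult:
  "\<lbrakk>g \<in> carrier G; x \<in> carrier G; y \<in> carrier G\<rbrakk> \<Longrightarrow> conj_by g (x \<otimes> y) = conj_by g x \<otimes> conj_by g y"
  by (simp add: conj_by_def m_assoc) (simp add: m_assoc[symmetric])

lemma conj_by_conj_by:
  "\<lbrakk>g \<in> carrier G; h \<in> carrier G; x \<in> carrier G\<rbrakk> \<Longrightarrow> conj_by h (conj_by g x) = conj_by (g \<otimes> h) x"
  by (simp add: conj_by_def m_assoc inv_mult_group)

lemma conj_by_one [simp]: "x \<in> carrier G \<Longrightarrow> conj_by \<one> x = x"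
  by (simp add: conj_by_def)

lemma mult_conj_by:
  "g \<in> carrier G \<Longrightarrow> x \<in> carrier G \<Longrightarrow> g \<otimes> conj_by g x = x \<otimes> g"
  by (simp add: conj_by_def m_assoc[symmetric])

lemma inj_conj_by: "g \<in> carrier G \<Longrightarrow> inj_on (conj_by g) (carrier G)"
  by (rule inj_onI) (simp add: conj_by_def m_assoc)

lemma wp_map_conj_by:
  "g \<in> carrier G \<Longrightarrow> set w \<subseteq> carrier G \<Longrightarrow> wp (map (conj_by g) w) = conj_by g (wp w)"
  by (induction w) (auto simp: conj_by_mult, simp add: conj_by_def)

lemma word_length_le: "w \<in> lists Z \<Longrightarrow> word_length G Z (wp w) \<le> length w"
  unfolding word_length_def by (rule Least_le) blast

lemma geodesic_word_exists:
  assumes "generating_set G Z" "g \<in> carrier G"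
  obtains w where "w \<in> lists Z" "wp w = g" "length w = word_length G Z g"
proof -
  have "g \<in> wp ` lists Z" using assms unfolding generating_set_def by blast
  then have "\<exists>n. \<exists>w\<in>lists Z. length w = n \<and> wp w = g" by blast
  from LeastI_ex[OF this] show thesis
    using that by (auto simp: word_length_def)
qed

end

section \<open>Multisets in an abelian normal subgroup\<close>

locale abelian_normal_subgroup = group G for G :: "('a, 'b) monoid_scheme" (structure) +
  fixes N :: "'a set"
  assumes normal_N: "N \<lhd> G"
    and commute: "\<lbrakk>a \<in> N; b \<in> N\<rbrakk> \<Longrightarrow> a \<otimes> b = b \<otimes> a"
begin

lemma subgroup_N: "subgroup N G"
  using normal_N by (rule normal_imp_subgroup)

lemma N_carrier: "N \<subseteq> carrier G"
  using subgroup_N by (rule subgroup.subset)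

lemma N_mult [simp]: "a \<in> N \<Longrightarrow> b \<in> N \<Longrightarrow> a \<otimes> b \<in> N"
  and N_one [simp]: "\<one> \<in> N"
  and N_inv [simp]: "a \<in> N \<Longrightarrow> inv a \<in> N"
  using subgroup_N by (auto simp: subgroup.m_closed subgroup.one_closed subgroup.m_inv_closed)

lemma in_carrier [simp]: "a \<in> N \<Longrightarrow> a \<in> carrier G"
  using N_carrier by blast

lemma conj_by_N [simp]: "g \<in> carrier G \<Longrightarrow> a \<in> N \<Longrightarrow> conj_by g a \<in> N"
  unfolding conj_by_def using normal.inv_op_closed1[OF normal_N] by blast

lemma wp_N [simp]: "set w \<subseteq> N \<Longrightarrow> wp w \<in> N"
  by (induction w) auto

lemma set_carrier: "set w \<subseteq> N \<Longrightarrow> set w \<subseteq> carrier G"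
  using N_carrier by blast

lemma wp_insert_middle:
  assumes "a \<in> N" "set u \<subseteq> N" "set v \<subseteq> N"
  shows "wp (u @ a # v) = a \<otimes> wp (u @ v)"
proof -
  have "wp (u @ a # v) = (wp u \<otimes> a) \<otimes> wp v"
    using assms set_carrier by (simp add: wp_append m_assoc)
  also have "\<dots> = a \<otimes> wp (u @ v)"
    using assms set_carrier by (simp add: commute[of "wp u" a] wp_append m_assoc)
  finally show ?thesis .
qed

lemma wp_cong_mset: "mset u = mset v \<Longrightarrow> set u \<subseteq> N \<Longrightarrow> wp u = wp v"
proof (induction u arbitrary: v)
  case (Cons a u)
  then have "a \<in> set v" by (metis list.set_intros(1) set_mset_mset)
  then obtain l r where v: "v = l @ a # r" by (meson split_list)
  have "set v \<subseteq> N" using Cons.prems by (metis set_mset_mset)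
  then have "wp v = a \<otimes> wp (l @ r)"
    using v by (simp add: wp_insert_middle)
  moreover have "wp u = wp (l @ r)"
    using Cons.prems v by (intro Cons.IH) auto
  ultimately show ?case by simp
qed simp

text \<open>
  The product of a multiset of elements of \<open>N\<close>. The choice of a listing is irrelevant for
  multisets over \<open>N\<close> because \<open>N\<close> is abelian.
\<close>

definition val :: "'a multiset \<Rightarrow> 'a" where
  "val M = wp (SOME w. mset w = M)"

lemma val_mset: "set w \<subseteq> N \<Longrightarrow> val (mset w) = wp w"
  unfolding val_def
  by (metis (mono_tags, lifting) wp_cong_mset someI_ex)

lemma val_closed [simp]: "set_mset M \<subseteq> N \<Longrightarrow> val M \<in> N"
  by (metis ex_mset set_mset_mset val_mset wp_N)

lemma val_add: "set_mset M \<subseteq> N \<Longrightarrow> set_mset M' \<subseteq> N \<Longrightarrow> val (M + M') = val M \<otimes> val M'"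
proof -
  assume M: "set_mset M \<subseteq> N" "set_mset M' \<subseteq> N"
  obtain u v where "M = mset u" "M' = mset v" by (metis ex_mset)
  then show ?thesis
    using M val_mset[of u] val_mset[of v] val_mset[of "u @ v"] set_carrier by (simp add: wp_append)
qed

lemma val_single [simp]: "a \<in> N \<Longrightarrow> val {#a#} = a"
  using val_mset[of "[a]"] by simp

lemma val_pair: "a \<in> N \<Longrightarrow> b \<in> N \<Longrightarrow> val {#a, b#} = a \<otimes> b"
  using val_mset[of "[a, b]"] by simp

lemma val_empty [simp]: "val {#} = \<one>"
  using val_mset[of "[]"] by simp

lemma val_image_conj_by:
  assumes "g \<in> carrier G" "set_mset M \<subseteq> N"
  shows "val (image_mset (conj_by g) M) = conj_by g (val M)"
proof -
  obtain u where u: "M = mset u" by (metis ex_mset)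
  then have "set (map (conj_by g) u) \<subseteq> N" using assms by auto
  from val_mset[OF this] show ?thesis
    using u assms set_carrier by (simp add: wp_map_conj_by val_mset)
qed

lemma val_diff:
  assumes "set_mset M \<subseteq> N" "set_mset M' \<subseteq> N"
  shows "inv (val M) \<otimes> val M' = inv (val (M - M')) \<otimes> val (M' - M)"
proof -
  have sub: "set_mset (M \<inter># M') \<subseteq> N" "set_mset (M - M') \<subseteq> N" "set_mset (M' - M) \<subseteq> N"
    using assms by (auto dest: in_diffD)
  have "M = (M \<inter># M') + (M - M')" "M' = (M \<inter># M') + (M' - M)"
    by (auto intro!: multiset_eqI)
  then have "val M = val (M \<inter># M') \<otimes> val (M - M')" "val M' = val (M \<inter># M') \<otimes> val (M' - M)"
    using val_add sub by metis+
  then show ?thesis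
    using sub by (simp add: inv_mult_group m_assoc) (simp add: m_assoc[symmetric])
qed

end

text \<open>
  These are the properties of the letters that the proofs of NSC, FFTP and biautomaticity use.
  The assumption \<open>shorten\<close> will come from the pigeonhole principle in the quotient by \<open>N\<close>,
  and \<open>uncross\<close> from replacing two sets by their union and intersection. The letters in \<open>B\<close>
  have the largest size, so that in a word sorted by decreasing size they come first.
\<close>

locale balanced_generators = abelian_normal_subgroup +
  fixes A B :: "'a set" and sz :: "'a \<Rightarrow> nat" and m :: nat
  assumes finite_A: "finite A" and A_N: "A \<subseteq> N"
    and conj_A: "\<lbrakk>a \<in> A; g \<in> carrier G\<rbrakk> \<Longrightarrow> conj_by g a \<in> A"
    and sz_conj: "\<lbrakk>a \<in> A; g \<in> carrier G\<rbrakk> \<Longrightarrow> sz (conj_by g a) = sz a"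
    and finite_B: "finite B" and B_carrier: "B \<subseteq> carrier G" and B_N: "B \<inter> N = {}"
    and sz_B: "\<lbrakk>b \<in> B; b' \<in> B\<rbrakk> \<Longrightarrow> sz b = sz b'"
    and sz_A_B: "\<lbrakk>a \<in> A; b \<in> B\<rbrakk> \<Longrightarrow> sz a < sz b"
    and generating: "generating_set G (A \<union> B)"
    and shorten: "\<lbrakk>\<tau> \<in> lists B; m \<le> length \<tau>\<rbrakk>
      \<Longrightarrow> \<exists>s\<in>lists (A \<union> B). wp s = wp \<tau> \<and> length s < length \<tau>"
    and uncross: "\<lbrakk>a \<in> A; b \<in> A; a \<noteq> b; sz a = sz b\<rbrakk>
      \<Longrightarrow> \<exists>M. set_mset M \<subseteq> A \<and> val M = a \<otimes> b \<and> better (image_mset sz M) {#sz a, sz b#}"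
begin

abbreviation "Z \<equiv> A \<union> B"

lemma finite_Z: "finite Z"
  using finite_A finite_B by simp

lemma Z_carrier: "Z \<subseteq> carrier G"
  using A_N N_carrier B_carrier by blast

lemma lists_Z_carrier [simp]: "w \<in> lists Z \<Longrightarrow> set w \<subseteq> carrier G"
  using Z_carrier by auto

lemma lists_A_N [simp]: "w \<in> lists A \<Longrightarrow> set w \<subseteq> N"
  using A_N by auto

lemma lists_A_Z: "w \<in> lists A \<Longrightarrow> w \<in> lists Z"
  by auto

lemma lists_B_Z: "w \<in> lists B \<Longrightarrow> w \<in> lists Z"
  by auto

lemma msets_A_N [simp]: "set_mset M \<subseteq> A \<Longrightarrow> set_mset M \<subseteq> N"
  using A_N by auto

lemma word_of_mset:
  assumes "set_mset M \<subseteq> A"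
  obtains w where "w \<in> lists A" "mset w = M" "wp w = val M"
proof -
  obtain w where w: "mset w = M" using ex_mset by blast
  then have "w \<in> lists A" using assms by (auto simp flip: set_mset_mset)
  then show thesis using that w val_mset lists_A_N by metis
qed

lemma conj_mset_A: "set_mset M \<subseteq> A \<Longrightarrow> g \<in> carrier G \<Longrightarrow> set_mset (image_mset (conj_by g) M) \<subseteq> A"
  using conj_A by auto

lemma sz_conj_mset:
  "set_mset M \<subseteq> A \<Longrightarrow> g \<in> carrier G
    \<Longrightarrow> image_mset sz (image_mset (conj_by g) M) = image_mset sz M"
  using sz_conj by (auto simp: image_mset.compositionality intro!: image_mset_cong)

abbreviation len :: "'a \<Rightarrow> nat" where
  "len \<equiv> word_length G Z"

text \<open>
  A conjugate of a letter of \<open>A\<close> is again a single letter, so right multiplication by a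
  letter of \<open>A\<close> lengthens all conjugates of \<open>g\<close> by at most one.
\<close>

lemma len_mult_val:
  assumes "h \<in> carrier G" "g \<in> carrier G" "set_mset M \<subseteq> A"
  shows "len (h \<otimes> (g \<otimes> val M) \<otimes> inv h) \<le> len (h \<otimes> g \<otimes> inv h) + size M"
proof -
  obtain u where u: "u \<in> lists Z" "wp u = h \<otimes> g \<otimes> inv h" "length u = len (h \<otimes> g \<otimes> inv h)"
    using geodesic_word_exists[OF generating] assms by (metis inv_closed m_closed)
  define M' where "M' = image_mset (conj_by (inv h)) M"
  have "set_mset M' \<subseteq> A" unfolding M'_def using assms by (intro conj_mset_A) auto
  then obtain v where v: "v \<in> lists A" "mset v = M'" "wp v = val M'"
    by (rule word_of_mset)
  have "val M \<in> carrier G" using assms(3) by simp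
  moreover have "val M' = h \<otimes> val M \<otimes> inv h"
    using assms by (simp add: M'_def val_image_conj_by conj_by_def)
  ultimately have "wp (u @ v) = h \<otimes> (g \<otimes> val M) \<otimes> inv h"
    using u v assms by (simp add: wp_append lists_A_Z m_assoc) (simp add: m_assoc[symmetric])
  moreover have "len (wp (u @ v)) \<le> length (u @ v)"
    using u(1) v(1) by (intro word_length_le) auto
  moreover have "length v = size M" using v(2) by (metis M'_def size_image_mset size_mset)
  ultimately show ?thesis using u(3) by simp
qed

section \<open>Moving the abelian letters to the right\<close>

definition skel :: "'a list \<Rightarrow> 'a list" where
  "skel w = filter (\<lambda>x. x \<notin> N) w"

text \<open>
  Moving \<open>x \<in> N\<close> to the right past \<open>g\<close> turns it into \<open>conj_by g x\<close>. As the letters in \<open>N\<close>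
  commute with each other, \<open>x\<close> gets conjugated only by the skeleton that follows it.
\<close>

primrec push :: "'a list \<Rightarrow> 'a list" where
  "push [] = []"
| "push (x # w) = (if x \<in> N then conj_by (wp (skel w)) x # push w else push w)"

lemma skel_append [simp]: "skel (u @ v) = skel u @ skel v"
  by (simp add: skel_def)

lemma Z_cases:
  assumes "x \<in> Z" obtains "x \<in> A" "x \<in> N" "x \<notin> B" | "x \<in> B" "x \<notin> N" "x \<notin> A"
  using assms A_N B_N by blast

lemma skel_B [simp]: "w \<in> lists Z \<Longrightarrow> skel w \<in> lists B"
  unfolding skel_def using A_N by (fastforce simp: in_lists_conv_set)

lemma skel_carrier [simp]: "w \<in> lists Z \<Longrightarrow> set (skel w) \<subseteq> carrier G"
  by (simp add: skel_B lists_B_Z)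

lemma push_A [simp]: "w \<in> lists Z \<Longrightarrow> push w \<in> lists A"
proof (induction w)
  case (Cons x w)
  then have w: "w \<in> lists Z" and x: "x \<in> Z" by auto
  from x show ?case
    by (rule Z_cases) (use Cons.IH[OF w] w in \<open>simp_all add: conj_A\<close>)
qed simp

lemma mset_push_A [simp]: "w \<in> lists Z \<Longrightarrow> set_mset (mset (push w)) \<subseteq> A"
  using push_A[of w] by (simp add: in_lists_conv_set subset_eq)

lemma wp_skel_push: "w \<in> lists Z \<Longrightarrow> wp w = wp (skel w) \<otimes> wp (push w)"
proof (induction w)
  case (Cons x w)
  have w: "w \<in> lists Z" and x: "x \<in> Z" using Cons.prems by auto
  have car: "wp (skel w) \<in> carrier G" "wp (push w) \<in> carrier G" "x \<in> carrier G"
    using w x Z_carrier lists_A_N[OF push_A[OF w]] wp_N by auto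
  show ?case
  proof (cases "x \<in> N")
    case True
    then have "wp (skel (x # w)) \<otimes> wp (push (x # w))
      = (wp (skel w) \<otimes> conj_by (wp (skel w)) x) \<otimes> wp (push w)"
      using car by (simp add: skel_def m_assoc)
    also have "\<dots> = x \<otimes> (wp (skel w) \<otimes> wp (push w))"
      using car by (simp add: mult_conj_by m_assoc)
    finally show ?thesis using Cons.IH[OF w] by simp
  next
    case False
    then show ?thesis using Cons.IH[OF w] car by (simp add: skel_def m_assoc)
  qed
qed (simp add: skel_def)

lemma wp_skel_val: "w \<in> lists Z \<Longrightarrow> wp w = wp (skel w) \<otimes> val (mset (push w))"
  by (simp add: wp_skel_push val_mset)

lemma sz_skel_push:
  "w \<in> lists Z \<Longrightarrow> image_mset sz (mset w) = image_mset sz (mset (skel w)) + image_mset sz (mset (push w))"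
proof (induction w)
  case (Cons x w)
  then have w: "w \<in> lists Z" and x: "x \<in> Z" by auto
  have car: "wp (skel w) \<in> carrier G" using w by simp
  from x show ?case
    by (rule Z_cases) (use Cons.IH[OF w] sz_conj[OF _ car] in \<open>simp_all add: skel_def\<close>)
qed (simp add: skel_def)

lemma length_skel_push: "w \<in> lists Z \<Longrightarrow> length w = length (skel w) + length (push w)"
  using arg_cong[OF sz_skel_push, of w size] by simp

lemma push_append:
  "u \<in> lists Z \<Longrightarrow> v \<in> lists Z \<Longrightarrow> push (u @ v) = map (conj_by (wp (skel v))) (push u) @ push v"
proof (induction u)
  case (Cons x u)
  then have u: "u \<in> lists Z" and x: "x \<in> Z" by auto
  have car: "wp (skel u) \<in> carrier G" "wp (skel v) \<in> carrier G" "x \<in> carrier G"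
    using u x Cons.prems(2) Z_carrier by auto
  show ?case
    using Cons.IH[OF u Cons.prems(2)] u Cons.prems(2) car by (simp add: wp_append conj_by_conj_by)
qed simp

lemma geodesic_skel_short:
  assumes "geodesic_word G Z w" shows "length (skel w) < m"
proof (rule ccontr)
  assume long: "\<not> ?thesis"
  have w: "w \<in> lists Z" "length w = len (wp w)" using assms by (auto simp: geodesic_word_def)
  then obtain s where s: "s \<in> lists Z" "wp s = wp (skel w)" "length s < length (skel w)"
    using shorten[of "skel w"] long by auto
  have p: "push w \<in> lists Z" using w push_A lists_A_Z by blast
  then have "wp (s @ push w) = wp w"
    using s(1,2) p w(1) wp_skel_push[OF w(1)] by (simp add: wp_append)
  moreover have "len (wp (s @ push w)) \<le> length (s @ push w)"
    using s p by (intro word_length_le) auto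
  ultimately show False using w s length_skel_push[of w] by simp
qed

definition skels :: "'a list set" where
  "skels = {\<tau> \<in> lists B. length \<tau> \<le> m}"

lemma finite_skels: "finite skels"
  using finite_lists_length_le[OF finite_B, of m] by (simp add: skels_def in_lists_conv_set subset_code(1))

lemma skel_in_skels: "w \<in> lists Z \<Longrightarrow> length (skel w) \<le> m \<Longrightarrow> skel w \<in> skels"
  by (simp add: skels_def)

lemma truncate_A: "set_mset M \<subseteq> A \<Longrightarrow> set_mset (truncate c A' M) \<subseteq> A"
  by (rule subset_trans[OF set_mset_mono[OF truncate_subset]])

section \<open>The neighboring shorter conjugate property\<close>

lemma len_extend:
  assumes "\<tau> \<in> lists B" "M \<subseteq># M'" "set_mset M' \<subseteq> A" "h \<in> carrier G"
  shows "len (h \<otimes> (wp \<tau> \<otimes> val M') \<otimes> inv h) \<le>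
    len (h \<otimes> (wp \<tau> \<otimes> val M) \<otimes> inv h) + (size M' - size M)"
proof -
  have \<tau>: "wp \<tau> \<in> carrier G" using assms(1) lists_B_Z by simp
  have sub: "set_mset M \<subseteq> A" "set_mset (M' - M) \<subseteq> A"
    using assms(2,3) by (auto dest: in_diffD mset_subset_eqD)
  have "M' = M + (M' - M)" using assms(2) by simp
  then have "val M' = val M \<otimes> val (M' - M)"
    using sub by (metis msets_A_N val_add)
  then have "wp \<tau> \<otimes> val M' = (wp \<tau> \<otimes> val M) \<otimes> val (M' - M)"
    using \<tau> sub by (simp add: m_assoc)
  then show ?thesis
    using len_mult_val[of h "wp \<tau> \<otimes> val M" "M' - M"] assms \<tau> sub by (simp add: size_Diff_submset)
qed

text \<open>
  Any conjugator that shortens \<open>\<tau> @ v\<close> also shortens \<open>\<tau> @ v'\<close> for every \<open>v'\<close> with more letters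
  than \<open>v\<close>. So it suffices to keep one conjugator for each \<open>\<tau>\<close> and each truncated multiset.
\<close>

theorem NSC_Z: "NSC G Z"
proof -
  define short where "short = (\<lambda>\<tau> M h. h \<in> carrier G \<and>
    len (h \<otimes> (wp \<tau> \<otimes> val M) \<otimes> inv h) < length \<tau> + size M)"
  have up: "\<exists>h. short \<tau> M' h"
    if "\<tau> \<in> skels" "\<exists>h. short \<tau> M h" "M \<subseteq># M'" "set_mset M' \<subseteq> A" for \<tau> M M'
  proof -
    from that obtain h where h: "short \<tau> M h" by blast
    have "size M \<le> size M'" using that(3) by (rule size_mset_mono)
    moreover have "len (h \<otimes> (wp \<tau> \<otimes> val M') \<otimes> inv h)
      \<le> len (h \<otimes> (wp \<tau> \<otimes> val M) \<otimes> inv h) + (size M' - size M)"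
      using that(1,3,4) h by (intro len_extend) (simp_all add: short_def skels_def)
    ultimately have "short \<tau> M' h"
      using h unfolding short_def by linarith
    then show ?thesis by blast
  qed
  obtain c where c: "\<And>\<tau> M. \<lbrakk>\<tau> \<in> skels; set_mset M \<subseteq> A; \<exists>h. short \<tau> M h\<rbrakk>
      \<Longrightarrow> \<exists>h. short \<tau> (truncate c A M) h"
    using upward_closed_detected_by_truncation[OF finite_skels finite_A, of "\<lambda>\<tau> M. \<exists>h. short \<tau> M h"] up
    by blast
  define conjugators where
    "conjugators = (\<lambda>(\<tau>, V). SOME h. short \<tau> V h) ` (skels \<times> range (truncate c A))"
  define K where "K = Max (len ` conjugators \<union> {0})"
  have fin: "finite (len ` conjugators \<union> {0})"
    unfolding conjugators_def using finite_cartesian_product[OF finite_skels finite_truncations]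
    by blast
  have "\<exists>g\<in>carrier G. len g \<le> K \<and> len (g \<otimes> wp (rotate 0 U) \<otimes> inv g) < length U"
    if U: "cyclic_geodesic G Z U" and h: "h \<in> carrier G" "len (h \<otimes> wp U \<otimes> inv h) < length U" for U h
  proof -
    have geo: "geodesic_word G Z U"
      using U unfolding cyclic_geodesic_def by (metis rotate0 id_apply)
    then have UZ: "U \<in> lists Z" by (simp add: geodesic_word_def)
    define \<tau> M V where "\<tau> = skel U" and "M = mset (push U)" and "V = truncate c A M"
    have \<tau>: "\<tau> \<in> skels" unfolding \<tau>_def using geodesic_skel_short[OF geo] UZ by (simp add: skel_in_skels)
    have M: "set_mset M \<subseteq> A" unfolding M_def using UZ by (rule mset_push_A)
    have wpU: "wp U = wp \<tau> \<otimes> val M" and lenU: "length U = length \<tau> + size M"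
      using UZ by (simp_all add: \<tau>_def M_def wp_skel_val length_skel_push)
    have "short \<tau> M h" using h by (simp add: short_def wpU lenU)
    then have "\<exists>h. short \<tau> V h" unfolding V_def using c \<tau> M by blast
    then have "short \<tau> V (SOME h. short \<tau> V h)" by (rule someI_ex)
    then obtain g where g: "g \<in> conjugators" "short \<tau> V g"
      using \<tau> by (force simp: conjugators_def V_def)
    have VM: "V \<subseteq># M" unfolding V_def by (rule truncate_subset)
    then have "size V \<le> size M" by (rule size_mset_mono)
    moreover have "len (g \<otimes> (wp \<tau> \<otimes> val M) \<otimes> inv g)
      \<le> len (g \<otimes> (wp \<tau> \<otimes> val V) \<otimes> inv g) + (size M - size V)"
      using VM g(2) M \<tau> by (intro len_extend) (simp_all add: short_def skels_def)
    ultimately have "short \<tau> M g"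
      using g(2) unfolding short_def by linarith
    moreover have "len g \<le> K" unfolding K_def using g(1) fin by (intro Max_ge) auto
    ultimately show ?thesis by (auto simp: short_def wpU lenU)
  qed
  then show ?thesis unfolding NSC_def by blast
qed

section \<open>The falsification by fellow traveler property\<close>

lemma Nil_geodesic: "geodesic_word G Z []"
  using word_length_le[of "[]" Z] by (simp add: geodesic_word_def)

text \<open>
  The shortest prefix that is not geodesic works: without its last letter it is geodesic.
\<close>

lemma not_geodesic_prefix:
  assumes "w \<in> lists Z" "\<not> geodesic_word G Z w"
  shows "\<exists>u v. w = u @ v \<and> \<not> geodesic_word G Z u \<and> length (skel u) \<le> m"
  using assms
proof (induction w rule: rev_induct)
  case (snoc x w)
  show ?case
  proof (cases "geodesic_word G Z w")
    case True
    then have "length (skel (w @ [x])) \<le> m"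
      using geodesic_skel_short[OF True] by (simp add: skel_def)
    then show ?thesis using snoc.prems by (intro exI[of _ "w @ [x]"] exI[of _ "[]"]) auto
  next
    case False
    then obtain u v where "w = u @ v" "\<not> geodesic_word G Z u" "length (skel u) \<le> m"
      using snoc by auto
    then show ?thesis by (intro exI[of _ u] exI[of _ "v @ [x]"]) auto
  qed
qed (simp add: Nil_geodesic)

lemma length_push: "length (push w) = length (filter (\<lambda>x. x \<in> N) w)"
  by (induction w) auto

text \<open>
  A multiset \<open>V\<close> of letters is removed from \<open>push w\<close>, and a word \<open>s\<close> that replaces \<open>\<tau>\<close>
  and the letters in \<open>V\<close> is put in front, where \<open>\<tau> = skel w\<close>. Compare a vertex of the old
  path, where the prefix \<open>u\<close> of \<open>w = u @ v\<close> has been read, with the vertex of the new path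
  after reading \<open>s\<close> and what is left of the letters that come from \<open>u\<close>. They differ by the
  skeleton of \<open>v\<close>, past which the letters have been pushed, and by the letters of \<open>V\<close> that \<open>u\<close>
  does not contain yet. Both come from finite sets.
\<close>

lemma FFTP_detour:
  assumes g: "g \<in> carrier G" and w: "w \<in> lists Z"
    and skelw: "length (skel w) \<le> m" and V: "V \<subseteq># mset (push w)"
    and s: "s \<in> lists Z" "wp s = wp (skel w) \<otimes> val V" "length s < length (skel w) + size V"
    and K: "\<And>\<tau> U. \<tau> \<in> skels \<Longrightarrow> U \<subseteq># V \<Longrightarrow> len (wp \<tau> \<otimes> val U) \<le> K"
      "\<And>t. len (wp (take t s)) \<le> K"
    and x: "x \<in> lists Z"
  defines "r \<equiv> delete_letters V (push w)"
  shows "(g, s @ r @ x) \<in> cayley_paths G Z"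
    and "wp (s @ r @ x) = wp (w @ x)"
    and "length (s @ r @ x) < length (w @ x)"
    and "async_fellow_travel G Z K (g, w @ x) (g, s @ r @ x)"
proof -
  define l where "l = push w"
  have l: "l \<in> lists A" "set_mset (mset l) \<subseteq> A" unfolding l_def using w push_A mset_push_A by blast+
  have rl: "set r \<subseteq> set l" unfolding r_def l_def by (rule set_delete_letters)
  have rA: "r \<in> lists A" using rl l by auto
  then have rZ: "r \<in> lists Z" by (rule lists_A_Z)
  have VA: "set_mset V \<subseteq> A" using set_mset_mono[OF V] l by (simp add: l_def)
  show path: "(g, s @ r @ x) \<in> cayley_paths G Z"
    using g s(1) rZ x by (simp add: cayley_paths_def)
  have mr: "mset r = mset l - V" by (simp add: r_def l_def mset_delete_letters)
  have "size (mset l) = size V + size (mset r)"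
    using V mr by (metis l_def add_diff_cancel_right' mset_subset_eq_exists_conv size_union add.commute)
  then show "length (s @ r @ x) < length (w @ x)"
    using s(3) length_skel_push[OF w] by (simp add: l_def)
  have "val V \<otimes> wp r = wp l"
  proof -
    have "V + mset r = mset l" using V mr by (simp add: l_def)
    moreover have "wp r = val (mset r)" "wp l = val (mset l)"
      using rA l by (simp_all add: val_mset)
    moreover have "set_mset (mset r) \<subseteq> A" using rA by auto
    ultimately show ?thesis using VA by (metis msets_A_N val_add)
  qed
  moreover have cl: "wp (skel w) \<in> carrier G" "val V \<in> carrier G" "wp r \<in> carrier G"
    using w VA rZ by simp_all
  ultimately have wpsr: "wp (s @ r) = wp w"
    using s rZ wp_skel_push[OF w] by (simp add: wp_append m_assoc l_def)
  then show "wp (s @ r @ x) = wp (w @ x)"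
    using s(1) rZ x w wp_append[of "s @ r" x] wp_append[of w x] by simp
  \<comment> \<open>Here \<open>k t\<close> letters from \<open>A\<close> have been read at time \<open>t\<close>, and
     \<open>d (k t)\<close> of these are not deleted.\<close>
  define k where "k t = length (filter (\<lambda>x. x \<in> N) (take t w))" for t
  define d where "d j = length (delete_letters V (take j l))" for j
  define \<phi> where "\<phi> t = length s + d (k t) + (t - length w)" for t
  have d: "d j \<le> d (Suc j)" "d (Suc j) \<le> Suc (d j)" for j
    unfolding d_def by (rule length_delete_letters_take)+
  have k_cases: "k (Suc t) = k t \<or> t < length w \<and> k (Suc t) = Suc (k t)" for t
    by (cases "t < length w") (auto simp: k_def take_Suc_conv_app_nth)
  have k: "k t \<le> k (Suc t)" for t
    using k_cases[of t] by auto
  have mono: "mono \<phi>"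
    unfolding \<phi>_def using lift_Suc_mono_le[of d, OF d(1)] lift_Suc_mono_le[of k, OF k]
    by (intro monoI add_mono diff_le_mono) auto
  have slow: "\<phi> (Suc t) \<le> Suc (\<phi> t)" for t
    using k_cases[of t] d[of "k t"] by (auto simp: \<phi>_def)
  have unbounded: "\<exists>t. n \<le> \<phi> t" for n
    by (rule exI[of _ "n + length w"]) (simp add: \<phi>_def)
  have k_total: "k t = length l" if "length w \<le> t" for t
    using that by (simp add: k_def l_def length_push)
  have follow: "word_dist G Z (vertex_at G (g, w @ x) t) (vertex_at G (g, s @ r @ x) (\<phi> t)) \<le> K" for t
  proof (cases "t \<le> length w")
    case True
    define u v where "u = take t w" and "v = drop t w"
    have uv: "w = u @ v" "u \<in> lists Z" "v \<in> lists Z"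
      using w by (auto simp: u_def v_def dest: in_set_takeD in_set_dropD)
    define \<sigma> where "\<sigma> = wp (skel v)"
    have lt: "take (k t) l = map (conj_by \<sigma>) (push u)"
      using push_append[OF uv(2,3)] by (simp add: l_def uv(1)[symmetric] \<sigma>_def k_def u_def[symmetric] length_push[symmetric])
    define L where "L = mset (take (k t) l)"
    have LA: "set_mset L \<subseteq> A" using l by (auto simp: L_def dest: in_set_takeD)
    have car: "\<sigma> \<in> carrier G" "wp (push u) \<in> N" "wp (skel u) \<in> carrier G"
      using uv by (simp_all add: \<sigma>_def)
    have valL: "val L = conj_by \<sigma> (wp (push u))"
    proof -
      have "L = image_mset (conj_by \<sigma>) (mset (push u))" by (simp add: L_def lt)
      then show ?thesis using car(1) uv(2) by (simp add: val_image_conj_by val_mset)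
    qed
    define r' where "r' = delete_letters V (take (k t) l)"
    have r': "mset r' = L - V" by (simp add: r'_def L_def mset_delete_letters)
    have "set r' \<subseteq> A" using set_delete_letters[of V "take (k t) l"] LA by (simp add: r'_def L_def)
    then have r'A: "set r' \<subseteq> N" "set r' \<subseteq> carrier G" using A_N N_carrier by auto
    have "take (\<phi> t) (s @ r @ x) = s @ r'"
    proof -
      have "r = r' @ delete_letters (V - L) (drop (k t) l)"
        unfolding r_def r'_def L_def l_def[symmetric]
        by (subst append_take_drop_id[of "k t" l, symmetric], rule delete_letters_append)
      moreover have "\<phi> t = length s + length r'" using True by (simp add: \<phi>_def d_def r'_def)
      ultimately show ?thesis by simp
    qed
    then have q: "vertex_at G (g, s @ r @ x) (\<phi> t) = g \<otimes> (wp s \<otimes> wp r')"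
      using s(1) r'A by (simp add: vertex_at_def wp_append)
    have p: "vertex_at G (g, w @ x) t = g \<otimes> (wp (skel u) \<otimes> wp (push u))"
      using True wp_skel_push[OF uv(2)] by (simp add: vertex_at_def u_def[symmetric])
    have sub: "set_mset (V - L) \<subseteq> N" "set_mset (L - V) \<subseteq> N"
      using VA LA A_N by (auto dest: in_diffD)
    have "wp r' = val (L - V)" using val_mset[OF r'A(1)] r' by simp
    moreover have "val V \<otimes> val (L - V) = val L \<otimes> val (V - L)"
    proof -
      have "V + (L - V) = L + (V - L)" by (intro multiset_eqI) auto
      then show ?thesis using val_add[of V "L - V"] val_add[of L "V - L"] VA LA sub by simp
    qed
    moreover have "wp (skel w) = wp (skel u) \<otimes> \<sigma>"
      using uv by (simp add: wp_append \<sigma>_def)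
    ultimately have "wp s \<otimes> wp r' = wp (skel u) \<otimes> (\<sigma> \<otimes> conj_by \<sigma> (wp (push u))) \<otimes> val (V - L)"
      using s(2) valL car sub VA by (simp add: m_assoc)
    also have "\<dots> = (wp (skel u) \<otimes> wp (push u)) \<otimes> (\<sigma> \<otimes> val (V - L))"
      using car sub by (simp add: mult_conj_by m_assoc)
    finally have "vertex_at G (g, s @ r @ x) (\<phi> t) = vertex_at G (g, w @ x) t \<otimes> (\<sigma> \<otimes> val (V - L))"
      using p q g car sub by (simp add: m_assoc)
    moreover have "vertex_at G (g, w @ x) t \<in> carrier G" using p g car by simp
    ultimately have "word_dist G Z (vertex_at G (g, w @ x) t) (vertex_at G (g, s @ r @ x) (\<phi> t))
      = len (\<sigma> \<otimes> val (V - L))"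
      using car sub by (simp add: word_dist_def m_assoc[symmetric])
    also have "\<dots> \<le> K"
      unfolding \<sigma>_def using uv(1) skelw by (intro K(1) skel_in_skels[OF uv(3)]) auto
    finally show ?thesis .
  next
    case False
    have "\<phi> t = length s + length r + (t - length w)"
      using False by (simp add: \<phi>_def d_def k_total r_def l_def)
    then have "take (\<phi> t) (s @ r @ x) = s @ r @ take (t - length w) x" by simp
    moreover have "take t (w @ x) = w @ take (t - length w) x" using False by simp
    moreover have xt: "set (take (t - length w) x) \<subseteq> carrier G"
      using x Z_carrier by (auto dest: in_set_takeD)
    ultimately have "vertex_at G (g, s @ r @ x) (\<phi> t) = vertex_at G (g, w @ x) t"
      using wpsr w s(1) rZ wp_append[OF _ xt, of w] wp_append[OF _ xt, of "s @ r"]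
      by (simp add: vertex_at_def)
    moreover have "vertex_at G (g, w @ x) t \<in> carrier G"
      using g xt w False by (simp add: vertex_at_def)
    moreover have "len \<one> \<le> K" using K(2)[of 0] by simp
    ultimately show ?thesis by (simp add: word_dist_def)
  qed
  have start: "word_dist G Z (vertex_at G (g, w @ x) 0) (vertex_at G (g, s @ r @ x) t) \<le> K"
    if "t \<le> \<phi> 0" for t
  proof -
    have "t \<le> length s" using that by (simp add: \<phi>_def k_def d_def)
    moreover have "set (take t s) \<subseteq> carrier G" using s(1) Z_carrier by (auto dest: in_set_takeD)
    ultimately show ?thesis
      using K(2)[of t] g by (simp add: word_dist_def vertex_at_def m_assoc[symmetric])
  qed
  show "async_fellow_travel G Z K (g, w @ x) (g, s @ r @ x)"
    by (rule async_fellow_travel_if_reparametrised[OF mono slow unbounded follow start])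
qed

theorem FFTP_Z: "FFTP G Z"
proof -
  define P where "P = (\<lambda>\<tau> M. len (wp \<tau> \<otimes> val M) < length \<tau> + size M)"
  have up: "P \<tau> M'" if "\<tau> \<in> skels" "P \<tau> M" "M \<subseteq># M'" "set_mset M' \<subseteq> A" for \<tau> M M'
  proof -
    have sub: "set_mset M \<subseteq> A" using that by (meson order_trans set_mset_mono)
    have "wp \<tau> \<in> carrier G" using that(1) lists_B_Z by (simp add: skels_def)
    moreover have "val M \<in> carrier G" "val M' \<in> carrier G" using sub that(4) by simp_all
    ultimately have "len (wp \<tau> \<otimes> val M') \<le> len (wp \<tau> \<otimes> val M) + (size M' - size M)"
      using len_extend[of \<tau> M M' \<one>] that by (simp add: skels_def)
    then show ?thesis
      using that(2) size_mset_mono[OF that(3)] unfolding P_def by linarith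
  qed
  obtain c where c: "\<And>\<tau> M. \<lbrakk>\<tau> \<in> skels; set_mset M \<subseteq> A; P \<tau> M\<rbrakk> \<Longrightarrow> P \<tau> (truncate c A M)"
    using upward_closed_detected_by_truncation[OF finite_skels finite_A, of P] up by blast
  define geo where "geo = (\<lambda>\<tau> V. SOME s. s \<in> lists Z \<and> wp s = wp \<tau> \<otimes> val V \<and> length s = len (wp \<tau> \<otimes> val V))"
  define C where "C = repeat_mset c (mset_set A)"
  define F where "F = (\<lambda>(\<tau>, U). wp \<tau> \<otimes> val U) ` (skels \<times> {U. U \<subseteq># C})
    \<union> (\<Union>(\<tau>, V) \<in> skels \<times> {V. V \<subseteq># C}. wp ` set (prefixes (geo \<tau> V)))"
  define K where "K = Max (len ` F)"
  have "finite F" unfolding F_def using finite_skels finite_submultisets by auto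
  then have K: "len e \<le> K" if "e \<in> F" for e unfolding K_def using that by simp
  have "\<exists>q\<in>cayley_paths G Z. same_endpoints G (g, w) q \<and> path_length q < path_length (g, w) \<and>
      async_fellow_travel G Z K (g, w) q"
    if g: "g \<in> carrier G" and w: "w \<in> lists Z" and ng: "\<not> geodesic_word G Z w" for g w
  proof -
    obtain u x where u: "w = u @ x" "\<not> geodesic_word G Z u" "length (skel u) \<le> m"
      using not_geodesic_prefix[OF w ng] by blast
    then have uZ: "u \<in> lists Z" and xZ: "x \<in> lists Z" using w by auto
    define V where "V = truncate c A (mset (push u))"
    have VC: "V \<subseteq># C" by (simp add: V_def C_def truncate_def)
    have VM: "V \<subseteq># mset (push u)" unfolding V_def by (rule truncate_subset)
    have VA: "set_mset V \<subseteq> A" unfolding V_def using truncate_A mset_push_A[OF uZ] by blast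
    have \<tau>: "skel u \<in> skels" using u(3) uZ by (simp add: skel_in_skels)
    have "len (wp u) < length u"
      using u(2) uZ word_length_le[OF uZ] by (auto simp: geodesic_word_def)
    then have "P (skel u) (mset (push u))"
      using uZ by (simp add: P_def wp_skel_val length_skel_push)
    then have P: "P (skel u) V" unfolding V_def using c \<tau> mset_push_A[OF uZ] by blast
    have "wp (skel u) \<otimes> val V \<in> carrier G" using uZ VA by simp
    then have "\<exists>s. s \<in> lists Z \<and> wp s = wp (skel u) \<otimes> val V \<and> length s = len (wp (skel u) \<otimes> val V)"
      using geodesic_word_exists[OF generating] by metis
    then have s: "geo (skel u) V \<in> lists Z" "wp (geo (skel u) V) = wp (skel u) \<otimes> val V"
      "length (geo (skel u) V) = len (wp (skel u) \<otimes> val V)"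
      unfolding geo_def by (metis (mono_tags, lifting) someI_ex)+
    have K1: "len (wp \<tau> \<otimes> val U) \<le> K" if "\<tau> \<in> skels" "U \<subseteq># V" for \<tau> U
    proof -
      have "U \<subseteq># C" using that(2) VC by (rule subset_mset.order_trans)
      then show ?thesis using that(1) by (intro K) (auto simp: F_def)
    qed
    have K2: "len (wp (take t (geo (skel u) V))) \<le> K" for t
    proof -
      have "wp (take t (geo (skel u) V)) \<in> wp ` set (prefixes (geo (skel u) V))"
        by (simp add: take_is_prefix)
      then have "wp (take t (geo (skel u) V)) \<in> F" unfolding F_def using \<tau> VC by blast
      then show ?thesis by (rule K)
    qed
    have "length (geo (skel u) V) < length (skel u) + size V"
      using P s(3) by (simp add: P_def)
    note detour = FFTP_detour[OF g uZ u(3) VM s(1,2) this K1 K2 xZ]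
    show ?thesis
      by (intro bexI[OF _ detour(1)])
         (use detour(2-4) in \<open>auto simp: u(1) same_endpoints_def path_length_def vertex_at_def\<close>)
  qed
  then have "\<forall>p\<in>cayley_paths G Z. \<not> geodesic_path G Z p \<longrightarrow> (\<exists>q\<in>cayley_paths G Z.
      same_endpoints G p q \<and> path_length q < path_length p \<and> async_fellow_travel G Z K p q)"
    unfolding geodesic_path_def cayley_paths_def by (metis SigmaE snd_conv)
  then show ?thesis
    unfolding FFTP_def using finite_Z by blast
qed

section \<open>Minimal multisets\<close>

abbreviation cost :: "'a multiset \<Rightarrow> nat multiset" where
  "cost M \<equiv> image_mset sz M"

text \<open>
  This is optimality among the words over \<open>A\<close>. It is invariant under conjugation, since \<open>A\<close> is,
  whereas a conjugate of a word over \<open>Z\<close> need not be a word over \<open>Z\<close>.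
\<close>

definition minimal :: "'a multiset \<Rightarrow> bool" where
  "minimal M \<longleftrightarrow> set_mset M \<subseteq> A \<and>
    (\<forall>M'. set_mset M' \<subseteq> A \<longrightarrow> val M' = val M \<longrightarrow> \<not> better (cost M') (cost M))"

lemma minimal_A: "minimal M \<Longrightarrow> set_mset M \<subseteq> A"
  by (simp add: minimal_def)

lemma minimal_submultiset:
  assumes "minimal M" "M' \<subseteq># M" shows "minimal M'"
proof -
  have sub: "set_mset M' \<subseteq> A" "set_mset (M - M') \<subseteq> A"
    using assms set_mset_mono[OF assms(2)] by (auto simp: minimal_def dest: in_diffD)
  have M: "M = M' + (M - M')" using assms(2) by simp
  have "\<not> better (cost R) (cost M')" if R: "set_mset R \<subseteq> A" "val R = val M'" for R
  proof
    assume "better (cost R) (cost M')"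
    then have "better (cost (R + (M - M'))) (cost (M' + (M - M')))"
      unfolding image_mset_union better_add .
    moreover have "val (R + (M - M')) = val M"
      using R sub M val_add msets_A_N by metis
    moreover have "set_mset (R + (M - M')) \<subseteq> A" using R sub by simp
    ultimately show False using assms(1) M unfolding minimal_def by metis
  qed
  then show ?thesis using sub by (simp add: minimal_def)
qed

lemma minimal_cost_eq:
  "minimal M \<Longrightarrow> minimal M' \<Longrightarrow> val M = val M' \<Longrightarrow> cost M = cost M'"
  unfolding minimal_def by (metis better_total)

lemma minimal_cong:
  "minimal M \<Longrightarrow> set_mset M' \<subseteq> A \<Longrightarrow> val M' = val M \<Longrightarrow> cost M' = cost M \<Longrightarrow> minimal M'"
  by (simp add: minimal_def)

lemma minimal_conj:
  assumes "minimal M" "g \<in> carrier G" shows "minimal (image_mset (conj_by g) M)"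
proof -
  have MA: "set_mset M \<subseteq> A" using assms(1) by (rule minimal_A)
  have "\<not> better (cost R) (cost M)"
    if R: "set_mset R \<subseteq> A" "val R = val (image_mset (conj_by g) M)" for R
  proof -
    define R' where "R' = image_mset (conj_by (inv g)) R"
    have RN: "set_mset R \<subseteq> N" "set_mset M \<subseteq> N" using R(1) MA by simp_all
    have "val R' = conj_by (inv g) (conj_by g (val M))"
      using RN R(2) assms(2) by (simp add: R'_def val_image_conj_by)
    also have "\<dots> = val M" using RN assms(2) by (simp add: conj_by_conj_by)
    finally have "val R' = val M" .
    moreover have "set_mset R' \<subseteq> A" "cost R' = cost R"
      using R(1) assms(2) conj_mset_A sz_conj_mset by (simp_all add: R'_def del: set_image_mset)
    ultimately show ?thesis using assms(1) unfolding minimal_def by metis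
  qed
  then show ?thesis
    using conj_mset_A[OF MA assms(2)] sz_conj_mset[OF MA assms(2)] by (simp add: minimal_def del: set_image_mset)
qed

text \<open>
  If two letters of the same size are distinct, uncrossing replaces them by something better.
\<close>

lemma minimal_inj_sz:
  assumes "minimal M" shows "inj_on sz (set_mset M)"
proof (rule inj_onI, rule ccontr)
  fix a b assume ab: "a \<in># M" "b \<in># M" "sz a = sz b" "a \<noteq> b"
  have "{#a, b#} \<subseteq># M"
    using ab by (auto simp: subseteq_mset_def Suc_le_eq)
  then have min: "minimal {#a, b#}" by (rule minimal_submultiset[OF assms])
  then have A: "a \<in> A" "b \<in> A" using minimal_A by fastforce+
  then obtain R where "set_mset R \<subseteq> A" "val R = a \<otimes> b" "better (cost R) {#sz a, sz b#}"
    using uncross ab by blast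
  moreover have "val {#a, b#} = a \<otimes> b"
    using A A_N by (intro val_pair) auto
  ultimately show False using min by (simp add: minimal_def)
qed

text \<open>
  Since \<open>V\<^sub>2\<close> and \<open>V\<^sub>2'\<close> have the same value and cost, \<open>V\<^sub>1 + V\<^sub>2'\<close> is minimal too and hence
  has only one letter of each size. All sizes that occur in \<open>V\<^sub>2'\<close> occur in \<open>V\<^sub>2\<close> and so in
  \<open>V\<^sub>1\<close>; therefore \<open>V\<^sub>2\<close> and \<open>V\<^sub>2'\<close> are both made of letters of \<open>V\<^sub>1\<close>, where the cost
  determines the multiset.
\<close>

lemma minimal_increment_unique:
  assumes V: "minimal (V\<^sub>1 + V\<^sub>2)" and V': "minimal V\<^sub>2'" and val: "val V\<^sub>2' = val V\<^sub>2"
    and sub: "set_mset V\<^sub>2 \<subseteq> set_mset V\<^sub>1"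
  shows "V\<^sub>2' = V\<^sub>2"
proof -
  have V2: "minimal V\<^sub>2" using V by (rule minimal_submultiset) simp
  have cost: "cost V\<^sub>2' = cost V\<^sub>2" using V' V2 val by (rule minimal_cost_eq)
  have A: "set_mset V\<^sub>1 \<subseteq> A" "set_mset V\<^sub>2 \<subseteq> A" "set_mset V\<^sub>2' \<subseteq> A"
    using minimal_A[OF V] minimal_A[OF V'] by auto
  have "minimal (V\<^sub>1 + V\<^sub>2')"
    by (rule minimal_cong[OF V]) (use A cost val in \<open>simp_all add: val_add\<close>)
  then have inj: "inj_on sz (set_mset V\<^sub>1 \<union> set_mset V\<^sub>2')"
    using minimal_inj_sz by fastforce
  have sub': "set_mset V\<^sub>2' \<subseteq> set_mset V\<^sub>1"
  proof
    fix a assume a: "a \<in># V\<^sub>2'"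
    then have "sz a \<in># cost V\<^sub>2" using cost by (metis imageI set_image_mset)
    then obtain b where "b \<in># V\<^sub>1" "sz b = sz a" using sub by auto
    then show "a \<in># V\<^sub>1" using inj a by (metis UnCI inj_onD)
  qed
  have undo: "image_mset (inv_into (set_mset V\<^sub>1) sz) (cost V) = V" if "set_mset V \<subseteq> set_mset V\<^sub>1" for V
  proof -
    have "inj_on sz (set_mset V\<^sub>1)" using inj by (rule inj_on_subset) simp
    then have "image_mset (\<lambda>a. inv_into (set_mset V\<^sub>1) sz (sz a)) V = image_mset (\<lambda>a. a) V"
      using that by (intro image_mset_cong) auto
    then show ?thesis by (simp add: image_mset.compositionality comp_def)
  qed
  show ?thesis using undo[OF sub] undo[OF sub'] cost by simp
qed

definition discrepancy :: "'a multiset \<Rightarrow> 'a multiset \<Rightarrow> nat" where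
  "discrepancy M M' = size (M - M') + size (M' - M)"

lemma discrepancy_add [simp]: "discrepancy (M + V) (M' + V) = discrepancy M M'"
  by (simp add: discrepancy_def)

text \<open>
  In an unbounded sequence of pairs, pass to a subsequence \<open>(E i, E' i)\<close> that increases in both
  components. Let \<open>j\<close> be so large that \<open>E j - E 0\<close> contains every letter that ever gets added to
  \<open>E 0\<close>. After \<open>j\<close> both components grow by the same multiset, so the discrepancy stays
  constant, although it was to exceed every index.
\<close>

lemma minimal_discrepancy_bounded:
  assumes \<delta>: "\<delta> \<in> N"
  shows "\<exists>C. \<forall>M M'. minimal M \<longrightarrow> minimal M' \<longrightarrow> val M' = \<delta> \<otimes> val M \<longrightarrow> discrepancy M M' \<le> C"
proof (rule ccontr)
  assume "\<not> ?thesis"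
  then have "\<forall>C. \<exists>M M'. minimal M \<and> minimal M' \<and> val M' = \<delta> \<otimes> val M \<and> C < discrepancy M M'"
    by (simp add: not_le)
  then obtain F F' where F: "\<And>i. minimal (F i)" "\<And>i. minimal (F' i)"
    "\<And>i. val (F' i) = \<delta> \<otimes> val (F i)" "\<And>i. i < discrepancy (F i) (F' i)"
    by metis
  obtain r :: "nat \<Rightarrow> nat" where r: "strict_mono r"
    "\<forall>a\<in>A <+> A. mono (\<lambda>i. case a of Inl a \<Rightarrow> count (F (r i)) a | Inr a \<Rightarrow> count (F' (r i)) a)"
    using dickson_subseq[OF finite_Plus[OF finite_A finite_A],
        of "\<lambda>i a. case a of Inl a \<Rightarrow> count (F i) a | Inr a \<Rightarrow> count (F' i) a"] by blast
  define E E' where "E i = F (r i)" and "E' i = F' (r i)" for i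
  have E: "minimal (E i)" "minimal (E' i)" "val (E' i) = \<delta> \<otimes> val (E i)"
    "set_mset (E i) \<subseteq> A" "set_mset (E' i) \<subseteq> A" for i
    using F minimal_A unfolding E_def E'_def by blast+
  have "count (E i) a \<le> count (E j) a" if "i \<le> j" for i j a
  proof (cases "a \<in> A")
    case True
    then have "mono (\<lambda>i. count (F (r i)) a)" using bspec[OF r(2) InlI[OF True]] by simp
    then show ?thesis using that by (simp add: E_def mono_def)
  next
    case False
    then have "a \<notin># E i" using E(4)[of i] by blast
    then show ?thesis by (simp add: not_in_iff)
  qed
  then have mono: "E i \<subseteq># E j" if "i \<le> j" for i j using that by (simp add: subseteq_mset_def)
  have "count (E' i) a \<le> count (E' j) a" if "i \<le> j" for i j a
  proof (cases "a \<in> A")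
    case True
    then have "mono (\<lambda>i. count (F' (r i)) a)" using bspec[OF r(2) InrI[OF True]] by simp
    then show ?thesis using that by (simp add: E'_def mono_def)
  next
    case False
    then have "a \<notin># E' i" using E(5)[of i] by blast
    then show ?thesis by (simp add: not_in_iff)
  qed
  then have mono': "E' i \<subseteq># E' j" if "i \<le> j" for i j using that by (simp add: subseteq_mset_def)
  define T where "T j = set_mset (E j - E 0)" for j
  have TA: "T j \<subseteq> A" for j using E(4) by (auto simp: T_def dest: in_diffD)
  have "\<forall>j. True \<longrightarrow> card (T j) < Suc (card A)"
    using card_mono[OF finite_A TA] by (simp add: less_Suc_eq_le)
  then obtain j where j: "\<And>k. card (T k) \<le> card (T j)"
    using ex_has_greatest_nat[of "\<lambda>_. True" 0 "\<lambda>j. card (T j)" "Suc (card A)"] by blast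
  \<comment> \<open>As the \<open>k\<close>-th pair has discrepancy greater than \<open>k\<close>, this index makes a constant
    discrepancy contradictory.\<close>
  define k where "k = j + discrepancy (E j) (E' j)"
  have jk: "j \<le> k" by (simp add: k_def)
  have "T j \<subseteq> T k"
    unfolding T_def using mono[OF jk]
    by (intro set_mset_mono) (simp add: subseteq_mset_def diff_le_mono)
  then have Tjk: "T k = T j"
    using card_seteq[of "T k" "T j"] j[of k] finite_subset[OF TA finite_A] by auto
  define V\<^sub>1 V\<^sub>2 V\<^sub>2' where "V\<^sub>1 = E j - E 0" and "V\<^sub>2 = E k - E j" and "V\<^sub>2' = E' k - E' j"
  have Ek: "E k = E j + V\<^sub>2" "E' k = E' j + V\<^sub>2'"
    using mono[OF jk] mono'[OF jk] by (simp_all add: V\<^sub>2_def V\<^sub>2'_def)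
  have V12: "V\<^sub>1 + V\<^sub>2 = E k - E 0"
    using mono[of 0 j] by (simp add: V\<^sub>1_def Ek(1) subset_mset.add_diff_assoc2)
  have VA: "set_mset V\<^sub>2 \<subseteq> A" "set_mset V\<^sub>2' \<subseteq> A"
    using E(4,5)[of k] by (auto simp: V\<^sub>2_def V\<^sub>2'_def dest: in_diffD)
  have "V\<^sub>2' = V\<^sub>2"
  proof (rule minimal_increment_unique)
    show "minimal (V\<^sub>1 + V\<^sub>2)" unfolding V12 using E(1)[of k] by (rule minimal_submultiset) simp
    show "minimal V\<^sub>2'" unfolding V\<^sub>2'_def using E(2)[of k] by (rule minimal_submultiset) simp
    have "set_mset V\<^sub>2 \<subseteq> T k" unfolding T_def V12[symmetric] by simp
    then show "set_mset V\<^sub>2 \<subseteq> set_mset V\<^sub>1" unfolding Tjk by (simp add: T_def V\<^sub>1_def)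
    have N: "val V\<^sub>2 \<in> N" "val V\<^sub>2' \<in> N" "val (E j) \<in> N" using VA E(4) by simp_all
    have "(\<delta> \<otimes> val (E j)) \<otimes> val V\<^sub>2' = val (E' k)"
      using E(3)[of j] E(5) VA by (simp add: Ek(2) val_add)
    also have "\<dots> = \<delta> \<otimes> (val (E j) \<otimes> val V\<^sub>2)"
      using E(3)[of k] E(4) VA by (simp add: Ek(1) val_add)
    also have "\<dots> = (\<delta> \<otimes> val (E j)) \<otimes> val V\<^sub>2"
      using N \<delta> by (simp add: m_assoc)
    finally show "val V\<^sub>2' = val V\<^sub>2"
      using N \<delta> by simp
  qed
  then have "discrepancy (E k) (E' k) = discrepancy (E j) (E' j)" by (simp add: Ek)
  moreover have "k < discrepancy (E k) (E' k)"
    using F(4)[of "r k"] strict_mono_imp_increasing[OF r(1), of k] by (simp add: E_def E'_def)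
  ultimately show False by (simp add: k_def)
qed

section \<open>The language of sorted optimal words\<close>

definition optimal :: "'a list \<Rightarrow> bool" where
  "optimal w \<longleftrightarrow> w \<in> lists Z \<and>
    (\<forall>v\<in>lists Z. wp v = wp w \<longrightarrow> \<not> better (cost (mset v)) (cost (mset w)))"

lemma optimal_Z: "optimal w \<Longrightarrow> w \<in> lists Z"
  by (simp add: optimal_def)

lemma optimal_geodesic:
  assumes "optimal w" shows "geodesic_word G Z w"
proof (rule ccontr)
  assume ng: "\<not> geodesic_word G Z w"
  have w: "w \<in> lists Z" using assms by (rule optimal_Z)
  then obtain v where v: "v \<in> lists Z" "wp v = wp w" "length v = len (wp w)"
    using geodesic_word_exists[OF generating, of "wp w"] by auto
  then have "length v < length w"
    using word_length_le[OF w] ng w by (auto simp: geodesic_word_def)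
  then show False using assms v by (auto simp: optimal_def better_def)
qed

lemma optimal_prefix:
  assumes "optimal (u @ v)" shows "optimal u"
proof -
  have uv: "u \<in> lists Z" "v \<in> lists Z" using optimal_Z[OF assms] by auto
  have "\<not> better (cost (mset u')) (cost (mset u))" if u': "u' \<in> lists Z" "wp u' = wp u" for u'
  proof
    assume "better (cost (mset u')) (cost (mset u))"
    then have "better (cost (mset (u' @ v))) (cost (mset (u @ v)))"
      by (simp only: mset_append image_mset_union better_add)
    moreover have "wp (u' @ v) = wp (u @ v)" using u' uv by (simp add: wp_append)
    ultimately show False using assms u'(1) uv(2) unfolding optimal_def by (metis append_in_lists_conv)
  qed
  then show ?thesis using uv by (simp add: optimal_def)
qed

lemma optimal_suffix_minimal:
  assumes "optimal (u @ v)" "v \<in> lists A" shows "minimal (mset v)"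
proof -
  have uv: "u \<in> lists Z" "v \<in> lists Z" using optimal_Z[OF assms(1)] by auto
  have "\<not> better (cost M) (cost (mset v))" if M: "set_mset M \<subseteq> A" "val M = val (mset v)" for M
  proof
    assume b: "better (cost M) (cost (mset v))"
    obtain v' where v': "v' \<in> lists A" "mset v' = M" "wp v' = val M"
      using word_of_mset[OF M(1)] by blast
    have v'Z: "v' \<in> lists Z" using v'(1) by (rule lists_A_Z)
    have "better (cost (mset (u @ v'))) (cost (mset (u @ v)))"
      using b v'(2) better_add by (simp add: add.commute[of "cost (mset u)"])
    moreover have "wp v' = wp v" using v' M(2) assms(2) by (simp add: val_mset)
    then have "wp (u @ v') = wp (u @ v)" using v'Z uv by (simp add: wp_append)
    ultimately show False using assms(1) uv(1) v'Z unfolding optimal_def by (metis append_in_lists_conv)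
  qed
  moreover have "set_mset (mset v) \<subseteq> A" using assms(2) by auto
  ultimately show ?thesis by (simp add: minimal_def)
qed

abbreviation descending :: "'a list \<Rightarrow> bool" where
  "descending w \<equiv> sorted_wrt (\<lambda>x y. sz y \<le> sz x) w"

text \<open>
  A sorted optimal word is a word over \<open>B\<close> followed by a block for each letter of \<open>A\<close> in it.
  The order of the blocks is determined by the sizes, hence compatible with conjugation.
\<close>

definition \<L> :: "'a list set" where
  "\<L> = {w. optimal w \<and> descending w}"

abbreviation apart :: "'a list \<Rightarrow> 'a list" where
  "apart w \<equiv> filter (\<lambda>x. x \<in> N) w"

lemma apart_A: "w \<in> lists Z \<Longrightarrow> apart w \<in> lists A"
  using B_N by (fastforce simp: in_lists_conv_set)

lemma descending_split:
  "w \<in> lists Z \<Longrightarrow> descending w \<Longrightarrow> w = skel w @ apart w"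
proof (induction w)
  case (Cons x w)
  then have w: "w \<in> lists Z" and x: "x \<in> Z" and IH: "w = skel w @ apart w" by auto
  from x show ?case
  proof (cases rule: Z_cases)
    case 1
    have "y \<in> N" if "y \<in> set w" for y
    proof -
      have "y \<in> Z" "sz y \<le> sz x" using Cons.prems that by auto
      then show ?thesis using sz_A_B[OF 1(1), of y] A_N by (auto simp: not_le[symmetric])
    qed
    then show ?thesis using 1 by (auto simp: skel_def)
  next
    case 2
    then show ?thesis using IH by (simp add: skel_def)
  qed
qed (simp add: skel_def)

text \<open>
  An optimal word can be sorted without changing its value or cost: push the letters of \<open>A\<close> to
  the right and sort them there.
\<close>

lemma \<L>_surj:
  assumes "g \<in> carrier G" shows "g \<in> wp ` \<L>"
proof -
  have "g \<in> wp ` lists Z" using assms generating unfolding generating_set_def by blast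
  then obtain w0 where "w0 \<in> lists Z" "wp w0 = g" by blast
  then obtain w where w: "w \<in> lists Z" "wp w = g"
    "\<And>u. u \<in> lists Z \<Longrightarrow> wp u = g \<Longrightarrow> \<not> better (cost (mset u)) (cost (mset w))"
    using best_word_exists[OF finite_Z, of w0 "\<lambda>u. wp u = g" sz] by blast
  define v where "v = rev (sort_key sz (push w))"
  have mv: "mset v = mset (push w)" by (simp add: v_def)
  have vA: "v \<in> lists A"
    using mset_push_A[OF w(1)] mv by (metis in_lists_conv_set set_mset_mset subsetD)
  have "wp v = wp (push w)"
    using wp_cong_mset[OF mv] lists_A_N[OF vA] by blast
  then have wpw: "wp (skel w @ v) = g"
    using w(1,2) lists_A_Z[OF vA] wp_skel_push[OF w(1)] by (simp add: wp_append)
  have Z: "skel w @ v \<in> lists Z" using skel_B[OF w(1)] lists_B_Z lists_A_Z[OF vA] by simp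
  have "cost (mset (skel w @ v)) = cost (mset w)"
    using sz_skel_push[OF w(1)] mv by simp
  then have "optimal (skel w @ v)" using w(3) wpw Z by (simp add: optimal_def)
  moreover have "descending v"
    using sorted_sort_key[of sz "push w"] by (simp add: v_def sorted_wrt_rev sorted_wrt_map)
  moreover have "descending u" if "u \<in> lists B" for u
    using that by (induction u) (auto simp: in_lists_conv_set intro: eq_imp_le[OF sz_B])
  then have "descending (skel w)" using skel_B[OF w(1)] by blast
  moreover have "sz y \<le> sz x" if "x \<in> set (skel w)" "y \<in> set v" for x y
    using sz_A_B[of y x] that skel_B[OF w(1)] vA by (auto simp: in_lists_conv_set)
  ultimately have "skel w @ v \<in> \<L>" by (simp add: \<L>_def sorted_wrt_append)
  then show ?thesis using wpw by blast
qed

lemma \<L>_geodesic: "geodesic_language G Z \<L>"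
  by (simp add: geodesic_language_def \<L>_def optimal_geodesic)

lemma \<L>_append: "u @ v \<in> \<L> \<Longrightarrow> u \<in> \<L>"
  by (auto simp: \<L>_def sorted_wrt_append intro: optimal_prefix)

lemma \<L>_prefix_closed: "prefix_closed \<L>"
  unfolding prefix_closed_def prefix_def using \<L>_append by blast

section \<open>Regularity\<close>

lemma truncate_truncate_add:
  "truncate c A (truncate c A M + V) = truncate c A (M + V)"
  using finite_A by (intro multiset_eqI) (auto simp: count_truncate min_def)

text \<open>
  For \<open>\<tau> \<in> skels\<close> the multisets \<open>M\<close> that make \<open>\<tau>\<close> followed by \<open>M\<close> not optimal are upward
  closed. So whether a continuation of \<open>u\<close> is optimal depends only on the skeleton of \<open>u\<close>
  and a truncation of its multiset of letters in \<open>A\<close>, at least if it adds only letters of \<open>A\<close>.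
  It can be sorted and add letters of \<open>B\<close> only if \<open>u\<close> is equal to its skeleton. The set of
  the letters of \<open>u\<close> decides which continuations are sorted.
\<close>

lemma \<L>_regular: "regular_language Z \<L>"
proof -
  define P where "P = (\<lambda>\<tau> M. \<exists>v\<in>lists Z. wp v = wp \<tau> \<otimes> val M \<and>
    better (cost (mset v)) (cost (mset \<tau>) + cost M))"
  have up: "P \<tau> M'" if "\<tau> \<in> skels" "P \<tau> M" "M \<subseteq># M'" "set_mset M' \<subseteq> A" for \<tau> M M'
  proof -
    obtain v where v: "v \<in> lists Z" "wp v = wp \<tau> \<otimes> val M"
      "better (cost (mset v)) (cost (mset \<tau>) + cost M)"
      using \<open>P \<tau> M\<close> by (auto simp: P_def)
    have sub: "set_mset M \<subseteq> A" "set_mset (M' - M) \<subseteq> A"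
      using that(3,4) set_mset_mono[OF that(3)] by (auto dest: in_diffD)
    obtain u where u: "u \<in> lists A" "mset u = M' - M" "wp u = val (M' - M)"
      using word_of_mset[OF sub(2)] by blast
    have M': "M' = M + mset u" using that(3) u(2) by simp
    have uZ: "u \<in> lists Z" using u(1) by (rule lists_A_Z)
    have \<tau>: "wp \<tau> \<in> carrier G" using that(1) lists_B_Z by (simp add: skels_def)
    have "set_mset (mset u) \<subseteq> A" using u(1) by auto
    then have "val (M + mset u) = val M \<otimes> wp u"
      using sub(1) u(1) by (simp add: val_add val_mset)
    then have "val M' = val M \<otimes> wp u" using M' by metis
    then have "wp (v @ u) = wp \<tau> \<otimes> val M'"
      using v(1,2) uZ \<tau> sub(1) by (simp add: wp_append m_assoc)
    moreover have "better (cost (mset (v @ u))) (cost (mset \<tau>) + cost M')"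
      using v(3) better_add[of "cost (mset v)" "cost (mset u)" "cost (mset \<tau>) + cost M"]
      by (subst M') (simp add: add.assoc)
    moreover have "v @ u \<in> lists Z" using v(1) uZ by simp
    ultimately show ?thesis unfolding P_def by blast
  qed
  obtain c where c: "\<And>\<tau> M. \<lbrakk>\<tau> \<in> skels; set_mset M \<subseteq> A; P \<tau> M\<rbrakk> \<Longrightarrow> P \<tau> (truncate c A M)"
    using upward_closed_detected_by_truncation[OF finite_skels finite_A, of P] up by blast
  have optimal_iff: "optimal (\<tau> @ w) \<longleftrightarrow> \<not> P \<tau> (truncate c A (mset w))"
    if \<tau>: "\<tau> \<in> skels" and w: "w \<in> lists A" for \<tau> w
  proof -
    have wA: "set_mset (mset w) \<subseteq> A" using w by auto
    have Z: "\<tau> \<in> lists Z" "w \<in> lists Z" using \<tau> w lists_A_Z lists_B_Z by (auto simp: skels_def)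
    have "optimal (\<tau> @ w) \<longleftrightarrow> \<not> P \<tau> (mset w)"
      using Z w by (auto simp: optimal_def P_def wp_append val_mset)
    moreover have "P \<tau> (mset w) \<longleftrightarrow> P \<tau> (truncate c A (mset w))"
      using c[OF \<tau> wA] up[OF \<tau> _ truncate_subset wA] by blast
    ultimately show ?thesis by simp
  qed
  define f where "f u = (if u \<in> \<L> then Some (skel u, truncate c A (mset (apart u)), set u) else None)" for u
  have skels: "skel u \<in> skels" if "u \<in> \<L>" for u
    using geodesic_skel_short[OF optimal_geodesic, of u] that optimal_Z[of u]
    by (simp add: \<L>_def skel_in_skels)
  have "f ` lists Z \<subseteq> insert None (Some ` (skels \<times> range (truncate c A) \<times> Pow Z))"
    using skels by (auto simp: f_def)
  moreover have "finite (insert None (Some ` (skels \<times> range (truncate c A) \<times> Pow Z)))"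
    using finite_cartesian_product[OF finite_skels
        finite_cartesian_product[OF finite_truncations[of c A] finite_Pow_iff[THEN iffD2, OF finite_Z]]]
    by blast
  ultimately have fin: "finite (f ` lists Z)" by (rule finite_subset)
  have congruent: "u' @ v \<in> \<L>"
    if fu: "f u = f u'" and v: "v \<in> lists Z" and uv: "u @ v \<in> \<L>" for u u' v
  proof -
    have u: "u \<in> \<L>" using uv by (rule \<L>_append)
    then have u': "u' \<in> \<L>" using fu by (auto simp: f_def split: if_splits)
    have eq: "skel u = skel u'" "truncate c A (mset (apart u)) = truncate c A (mset (apart u'))"
      "set u = set u'"
      using fu u u' by (simp_all add: f_def)
    have uZ: "u \<in> lists Z" "u' \<in> lists Z" and desc: "descending u" "descending u'" "descending (u @ v)"
      using u u' uv optimal_Z by (auto simp: \<L>_def)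
    note split = descending_split[OF uZ(1) desc(1)] descending_split[OF uZ(2) desc(2)]
    show ?thesis
    proof (cases "apart u = []")
      case True
      then have "apart u' = []" using eq(3) by (simp add: filter_empty_conv)
      then have "u = u'" using True split eq(1) by simp
      then show ?thesis using uv by simp
    next
      case False
      then obtain a where a: "a \<in> set u" "a \<in> N" by (auto simp: filter_empty_conv)
      have aA: "a \<in> A" using a uZ(1) B_N by (auto simp: in_lists_conv_set)
      have "y \<in> A" if "y \<in> set v" for y
      proof -
        have "sz y \<le> sz a" using desc(3) a(1) that by (simp add: sorted_wrt_append)
        then show ?thesis using sz_A_B[OF aA, of y] v that by (auto simp: in_lists_conv_set not_le[symmetric])
      qed
      then have vA: "v \<in> lists A" by auto
      have A: "apart u @ v \<in> lists A" "apart u' @ v \<in> lists A"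
        using uZ apart_A vA by simp_all
      have "truncate c A (mset (apart u @ v)) = truncate c A (mset (apart u' @ v))"
        using truncate_truncate_add[of c "mset (apart u)" "mset v"]
          truncate_truncate_add[of c "mset (apart u')" "mset v"] eq(2) by simp
      moreover have "optimal (skel u @ apart u @ v)"
        using uv split(1) by (metis (no_types, lifting) \<L>_def append_assoc mem_Collect_eq)
      ultimately have "optimal (skel u' @ apart u' @ v)"
        using optimal_iff[OF skels[OF u] A(1)] optimal_iff[OF skels[OF u'] A(2)] eq(1) by simp
      then have "optimal (u' @ v)" using split(2) by (metis append_assoc)
      moreover have "descending (u' @ v)"
        using desc eq(3) by (simp add: sorted_wrt_append)
      ultimately show ?thesis by (simp add: \<L>_def)
    qed
  qed
  have "\<L> \<subseteq> lists Z" using optimal_Z by (auto simp: \<L>_def)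
  then show ?thesis
    by (rule regular_language_if_finite_congruence[OF _ fin]) (rule congruent)
qed

section \<open>Synchronous fellow travelling\<close>

lemma discrepancy_commute: "discrepancy M M' = discrepancy M' M"
  by (simp add: discrepancy_def)

lemma count_le_discrepancy: "count M a \<le> count M' a + discrepancy M M'"
  using count_le_size[of "M - M'" a] by (simp add: discrepancy_def)

lemma size_filter_le_discrepancy:
  "size (filter_mset Q M) \<le> size (filter_mset Q M') + discrepancy M M'"
proof -
  have "count M a \<le> count (M' + (M - M')) a" for a
    unfolding count_union count_diff by arith
  then have "filter_mset Q M \<subseteq># filter_mset Q (M' + (M - M'))"
    by (intro multiset_filter_mono mset_subset_eqI)
  then have "size (filter_mset Q M) \<le> size (filter_mset Q (M' + (M - M')))" by (rule size_mset_mono)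
  also have "\<dots> \<le> size (filter_mset Q M') + discrepancy M M'"
    using size_filter_mset_lesseq[of Q "M - M'"] by (simp add: discrepancy_def)
  finally show ?thesis .
qed

text \<open>
  By \<open>count_take_sorted\<close> the block of \<open>a\<close> has almost the same length in both words and starts
  at almost the same time.
\<close>

lemma count_take_le:
  assumes "descending u" "descending v" "minimal (mset u)" "minimal (mset v)"
    and "discrepancy (mset u) (mset v) \<le> C" and "s \<le> t + m"
  shows "count (mset (take s u)) a \<le> count (mset (take t v)) a + (C + m)"
proof (cases "a \<in> set u")
  case False
  then have "a \<notin> set (take s u)" by (meson in_set_takeD)
  then show ?thesis by (simp add: count_mset_0_iff[THEN iffD2])
next
  case au: True
  define h where "h w = size (filter_mset (\<lambda>b. sz a < sz b) (mset w))" for w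
  have inj: "inj_on sz (set u)" "inj_on sz (set v)"
    using minimal_inj_sz[OF assms(3)] minimal_inj_sz[OF assms(4)] by simp_all
  have cu: "count (mset (take s u)) a = min (count (mset u) a) (s - h u)"
    unfolding h_def by (rule count_take_sorted[OF assms(1) inj(1) au])
  have le: "count (mset u) a \<le> count (mset v) a + C" "h v \<le> h u + C"
    using assms(5) count_le_discrepancy[of "mset u" a "mset v"]
      size_filter_le_discrepancy[of "\<lambda>b. sz a < sz b" "mset v" "mset u"]
    by (auto simp: h_def discrepancy_commute)
  show ?thesis
  proof (cases "a \<in> set v")
    case True
    have "count (mset (take t v)) a = min (count (mset v) a) (t - h v)"
      unfolding h_def by (rule count_take_sorted[OF assms(2) inj(2) True])
    then show ?thesis unfolding cu using le assms(6) by arith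
  next
    case False
    then have "count (mset v) a = 0" by (simp add: count_mset_0_iff)
    then show ?thesis unfolding cu using le by linarith
  qed
qed

text \<open>
  Write \<open>W = \<tau> @ w\<close> and \<open>U = \<sigma> @ u\<close>. Moving \<open>y\<close> in \<open>U = x W y\<close> to the left of \<open>w\<close> conjugates
  the letters of \<open>w\<close>, giving a word \<open>w'\<close> that is again sorted and minimal. Then the value of
  \<open>u\<close> is \<open>\<delta>\<close> times that of \<open>w'\<close>, where \<open>\<delta> = \<sigma>\<^sup>-\<^sup>1 x \<tau> y\<close> belongs to a finite set. Hence \<open>u\<close> and
  \<open>w'\<close> have bounded discrepancy, their prefixes are close, and translating back costs only the
  bounded factors \<open>\<delta>\<close> and \<open>y\<close>. During the first \<open>m\<close> steps both paths stay in a finite set.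
\<close>

lemma \<L>_biautomatic: "biautomatic_structure G Z \<L>"
proof -
  define Z1 where "Z1 = Z \<union> {\<one>}"
  define \<Delta> where "\<Delta> = (\<lambda>(\<sigma>, x, \<tau>, y). inv (wp \<sigma>) \<otimes> (x \<otimes> wp \<tau> \<otimes> y)) ` (skels \<times> Z1 \<times> skels \<times> Z1)"
  have finZ1: "finite Z1" using finite_Z by (simp add: Z1_def)
  have Z1: "x \<in> carrier G" if "x \<in> Z1" for x using that Z_carrier by (auto simp: Z1_def)
  have fin\<Delta>: "finite \<Delta>"
    unfolding \<Delta>_def by (intro finite_imageI finite_cartesian_product finite_skels finZ1)
  have "\<forall>\<delta>\<in>\<Delta> \<inter> N. \<exists>C. \<forall>M M'. minimal M \<longrightarrow> minimal M' \<longrightarrow> val M' = \<delta> \<otimes> val M \<longrightarrow> discrepancy M M' \<le> C"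
    using minimal_discrepancy_bounded by blast
  then obtain D where D: "\<And>\<delta> M M'. \<lbrakk>\<delta> \<in> \<Delta> \<inter> N; minimal M; minimal M'; val M' = \<delta> \<otimes> val M\<rbrakk>
      \<Longrightarrow> discrepancy M M' \<le> D \<delta>"
    by (metis (no_types))
  define C where "C = Max (insert 0 (D ` \<Delta>))"
  have C: "D \<delta> \<le> C" if "\<delta> \<in> \<Delta>" for \<delta> unfolding C_def using that fin\<Delta> by simp
  define R where "R = repeat_mset (C + m) (mset_set A)"
  define S where "S = wp ` {w \<in> lists Z. length w \<le> m}"
  define F where "F = (\<lambda>(y, \<delta>, P, Q). y \<otimes> inv \<delta> \<otimes> (inv (val P) \<otimes> val Q)) `
      (Z1 \<times> \<Delta> \<times> {P. P \<subseteq># R} \<times> {Q. Q \<subseteq># R})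
    \<union> (\<lambda>(x, a, b). inv (x \<otimes> a) \<otimes> b) ` (Z1 \<times> S \<times> S)"
  have finS: "finite S"
    unfolding S_def using finite_lists_length_le[OF finite_Z, of m]
    by (simp add: in_lists_conv_set subset_code(1))
  have "finite F"
    unfolding F_def
    by (intro finite_UnI finite_imageI finite_cartesian_product finZ1 fin\<Delta> finS finite_submultisets)
  define K where "K = Max (len ` F)"
  have K: "len e \<le> K" if "e \<in> F" for e unfolding K_def using that \<open>finite F\<close> by simp
  have "sync_fellow_travel G Z K (x, W) (\<one>, U)"
    if W: "W \<in> \<L>" and U: "U \<in> \<L>" and x: "x \<in> Z1" and y: "y \<in> Z1"
      and eq: "wp U = x \<otimes> wp W \<otimes> y" for W U x y
  proof -
    have Z: "W \<in> lists Z" "U \<in> lists Z" and opt: "optimal W" "optimal U"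
      and desc: "descending W" "descending U"
      using W U optimal_Z by (auto simp: \<L>_def)
    define \<tau> w \<sigma> u where "\<tau> = skel W" and "w = apart W" and "\<sigma> = skel U" and "u = apart U"
    have split: "W = \<tau> @ w" "U = \<sigma> @ u"
      unfolding \<tau>_def w_def \<sigma>_def u_def using descending_split Z desc by blast+
    have short: "length \<tau> < m" "length \<sigma> < m"
      using geodesic_skel_short[OF optimal_geodesic] opt by (simp_all add: \<tau>_def \<sigma>_def)
    then have skels: "\<tau> \<in> skels" "\<sigma> \<in> skels" using Z by (simp_all add: \<tau>_def \<sigma>_def skel_in_skels)
    have wA: "w \<in> lists A" "u \<in> lists A" using Z by (simp_all add: w_def u_def apart_A)
    have car: "x \<in> carrier G" "y \<in> carrier G" "wp \<tau> \<in> carrier G" "wp \<sigma> \<in> carrier G"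
      using x y Z1 Z by (simp_all add: \<tau>_def \<sigma>_def)
    define w' where "w' = map (conj_by y) w"
    have w'A: "w' \<in> lists A" using wA(1) car(2) conj_A by (auto simp: w'_def)
    have min: "minimal (mset w')" "minimal (mset u)"
      using minimal_conj[OF optimal_suffix_minimal car(2), of \<tau> w] optimal_suffix_minimal[of \<sigma> u]
        opt split wA by (simp_all add: w'_def)
    have desc': "descending w'" "descending u"
    proof -
      have "descending w" using desc(1) split(1) by (simp add: sorted_wrt_append)
      then show "descending w'"
        using wA(1) sz_conj car(2) unfolding w'_def sorted_wrt_map
        by (elim sorted_wrt_mono_rel[rotated]) (auto simp: in_lists_conv_set)
      show "descending u" using desc(2) split(2) by (simp add: sorted_wrt_append)
    qed
    have conj_wp: "wp v \<otimes> y = y \<otimes> wp (map (conj_by y) v)" if "v \<in> lists A" for v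
      using lists_A_Z[OF that] car(2) by (simp add: wp_map_conj_by mult_conj_by)
    define \<delta> where "\<delta> = inv (wp \<sigma>) \<otimes> (x \<otimes> wp \<tau> \<otimes> y)"
    have \<delta>: "\<delta> \<in> \<Delta>" unfolding \<delta>_def \<Delta>_def using skels x y by force
    have \<delta>c: "\<delta> \<in> carrier G" using car by (simp add: \<delta>_def)
    have \<sigma>\<delta>: "wp \<sigma> \<otimes> \<delta> = x \<otimes> wp \<tau> \<otimes> y"
      using car by (simp add: \<delta>_def m_assoc[symmetric])
    have N: "wp w' \<in> N" "wp u \<in> N" using w'A wA(2) by simp_all
    have wc: "wp w \<in> carrier G" using lists_A_Z[OF wA(1)] by simp
    have "wp \<sigma> \<otimes> wp u = x \<otimes> (wp \<tau> \<otimes> wp w) \<otimes> y"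
      using eq Z skels lists_A_Z[OF wA(1)] lists_A_Z[OF wA(2)] lists_B_Z
      by (simp add: split wp_append skels_def)
    also have "\<dots> = x \<otimes> wp \<tau> \<otimes> (wp w \<otimes> y)"
      using car wc by (simp add: m_assoc)
    also have "\<dots> = (x \<otimes> wp \<tau> \<otimes> y) \<otimes> wp w'"
      using car N(1) by (simp add: conj_wp[OF wA(1)] w'_def[symmetric] m_assoc)
    finally have "wp \<sigma> \<otimes> wp u = wp \<sigma> \<otimes> (\<delta> \<otimes> wp w')"
      using car \<delta>c N(1) \<sigma>\<delta> by (simp add: m_assoc[symmetric])
    then have u\<delta>: "wp u = \<delta> \<otimes> wp w'" using car \<delta>c N by simp
    then have "\<delta> = wp u \<otimes> inv (wp w')" using \<delta>c N by (simp add: m_assoc)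
    then have \<delta>N: "\<delta> \<in> N" using N by simp
    have disc: "discrepancy (mset w') (mset u) \<le> C"
    proof -
      have "val (mset u) = \<delta> \<otimes> val (mset w')" using u\<delta> w'A wA(2) by (simp add: val_mset)
      then show ?thesis using D[of \<delta> "mset w'" "mset u"] C[OF \<delta>] \<delta> \<delta>N min by fastforce
    qed
    have takeZ: "take t W \<in> lists Z" "take t U \<in> lists Z" for t
      using Z by (auto simp: in_lists_conv_set dest: in_set_takeD)
    have "len (inv (x \<otimes> wp (take t W)) \<otimes> wp (take t U)) \<le> K" for t
    proof (cases "t \<le> m")
      case True
      then have "wp (take t W) \<in> S" "wp (take t U) \<in> S" using takeZ by (auto simp: S_def)
      then have "inv (x \<otimes> wp (take t W)) \<otimes> wp (take t U) \<in> F"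
        unfolding F_def using x by force
      then show ?thesis by (rule K)
    next
      case False
      define j k where "j = t - length \<tau>" and "k = t - length \<sigma>"
      have jk: "j \<le> k + m" "k \<le> j + m" using short by (simp_all add: j_def k_def)
      define M M' where "M = mset (take j w')" and "M' = mset (take k u)"
      have MA: "set_mset M \<subseteq> A" "set_mset M' \<subseteq> A"
        using w'A wA(2) by (auto simp: M_def M'_def in_lists_conv_set dest: in_set_takeD)
      have "count M a \<le> count M' a + (C + m)" "count M' a \<le> count M a + (C + m)" for a
        unfolding M_def M'_def using desc' min disc jk
        by (auto intro!: count_take_le simp: discrepancy_commute)
      moreover have "count M a = 0" "count M' a = 0" if "a \<notin> A" for a
        using MA that by (auto simp: count_eq_zero_iff)
      ultimately have "M - M' \<subseteq># R" "M' - M \<subseteq># R"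
        using finite_A unfolding R_def
        by (auto simp: subseteq_mset_def count_mset_set' le_diff_conv add.commute)
      then have inF: "y \<otimes> inv \<delta> \<otimes> (inv (val (M - M')) \<otimes> val (M' - M)) \<in> F"
        unfolding F_def using y \<delta> by force
      have tA: "take j w \<in> lists A" "take k u \<in> lists A"
        using wA by (auto simp: in_lists_conv_set dest: in_set_takeD)
      have take: "take t W = \<tau> @ take j w" "take t U = \<sigma> @ take k u"
        using False short by (simp_all add: split j_def k_def)
      have vM: "wp (map (conj_by y) (take j w)) = val M" "wp (take k u) = val M'"
        using val_mset[of "take j w'"] val_mset[of "take k u"]
          msets_A_N[OF MA(1)] msets_A_N[OF MA(2)] unfolding M_def M'_def set_mset_mset
        by (simp_all add: w'_def take_map)
      have vN: "val M \<in> N" "val M' \<in> N" using MA by simp_all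
      have wj: "wp (take j w) \<in> carrier G" using lists_A_Z[OF tA(1)] by simp
      have "x \<otimes> wp (take t W) \<otimes> y = x \<otimes> wp \<tau> \<otimes> (wp (take j w) \<otimes> y)"
        using car wj Z lists_A_Z[OF tA(1)] by (simp add: take wp_append \<tau>_def m_assoc)
      also have "\<dots> = (wp \<sigma> \<otimes> \<delta>) \<otimes> val M"
        using car vN by (simp add: conj_wp[OF tA(1)] vM \<sigma>\<delta> m_assoc)
      finally have "x \<otimes> wp (take t W) \<otimes> y = wp \<sigma> \<otimes> \<delta> \<otimes> val M" .
      moreover have "x \<otimes> wp (take t W) = (x \<otimes> wp (take t W) \<otimes> y) \<otimes> inv y"
        using car takeZ(1)[of t] by (simp add: m_assoc)
      ultimately have left: "x \<otimes> wp (take t W) = (wp \<sigma> \<otimes> \<delta> \<otimes> val M) \<otimes> inv y"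
        by simp
      have right: "wp (take t U) = wp \<sigma> \<otimes> val M'"
        using Z lists_A_Z[OF tA(2)] by (simp add: take wp_append \<sigma>_def vM)
      have "inv (x \<otimes> wp (take t W)) \<otimes> wp (take t U) = y \<otimes> (inv (val M) \<otimes> inv \<delta>) \<otimes> val M'"
        unfolding left right using car vN \<delta>c
        by (simp add: inv_mult_group m_assoc) (simp add: m_assoc[symmetric])
      also have "\<dots> = y \<otimes> inv \<delta> \<otimes> (inv (val M) \<otimes> val M')"
        using car vN \<delta>N by (simp add: commute[of "inv (val M)" "inv \<delta>"] m_assoc)
      also have "inv (val M) \<otimes> val M' = inv (val (M - M')) \<otimes> val (M' - M)"
        using MA by (intro val_diff) simp_all
      finally show ?thesis using K[OF inF] by simp
    qed
    then show ?thesis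
      using takeZ by (simp add: sync_fellow_travel_def word_dist_def vertex_at_def)
  qed
  moreover have "wp ` \<L> = carrier G"
    using \<L>_surj optimal_Z by (auto simp: \<L>_def)
  ultimately show ?thesis
    unfolding biautomatic_structure_def Z1_def using \<L>_regular by blast
qed

end

section \<open>Abelian normal subgroups of finite index\<close>

text \<open>
  \<open>N\<close> is the normal core of \<open>H\<close>. A coset of \<open>N\<close> is determined by the permutation that its
  elements induce on the finite set of cosets of \<open>H\<close>.
\<close>

lemma (in group) normal_core_of_abelian_subgroup:
  assumes H: "subgroup H G" "comm_group (G\<lparr>carrier := H\<rparr>)" "finite (rcosets H)"
  obtains N where "abelian_normal_subgroup G N" "finite (rcosets N)"
proof -
  define N where "N = {n \<in> carrier G. \<forall>g\<in>carrier G. g \<otimes> n \<otimes> inv g \<in> H}"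
  have HG: "H \<subseteq> carrier G" using H(1) by (rule subgroup.subset)
  have "subgroup N G"
  proof (rule subgroupI)
    show "N \<noteq> {}"
      using subgroup.one_closed[OF H(1)] by (auto simp: N_def intro!: exI[of _ \<one>])
    show "inv a \<in> N" if "a \<in> N" for a
    proof -
      have "g \<otimes> inv a \<otimes> inv g = inv (g \<otimes> a \<otimes> inv g)" if "g \<in> carrier G" for g
        using that \<open>a \<in> N\<close> by (simp add: N_def inv_mult_group m_assoc)
      then show ?thesis using \<open>a \<in> N\<close> subgroup.m_inv_closed[OF H(1)] by (simp add: N_def)
    qed
    show "a \<otimes> b \<in> N" if "a \<in> N" "b \<in> N" for a b
    proof -
      have "g \<otimes> (a \<otimes> b) \<otimes> inv g = (g \<otimes> a \<otimes> inv g) \<otimes> (g \<otimes> b \<otimes> inv g)" if "g \<in> carrier G" for g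
        using that \<open>a \<in> N\<close> \<open>b \<in> N\<close>
        by (simp add: N_def m_assoc) (simp add: m_assoc[symmetric])
      then show ?thesis using that subgroup.m_closed[OF H(1)] by (simp add: N_def)
    qed
  qed (auto simp: N_def)
  then have normal: "N \<lhd> G"
  proof (rule normal_invI)
    fix x n assume xn: "x \<in> carrier G" "n \<in> N"
    have "g \<otimes> (x \<otimes> n \<otimes> inv x) \<otimes> inv g = (g \<otimes> x) \<otimes> n \<otimes> inv (g \<otimes> x)" if "g \<in> carrier G" for g
      using that xn by (simp add: N_def m_assoc inv_mult_group)
    then show "x \<otimes> n \<otimes> inv x \<in> N" using xn by (simp add: N_def)
  qed
  have "N \<subseteq> H"
  proof
    fix n assume "n \<in> N"
    then have "\<one> \<otimes> n \<otimes> inv \<one> \<in> H" "n \<in> carrier G" unfolding N_def by blast+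
    then show "n \<in> H" by simp
  qed
  moreover have "a \<otimes> b = b \<otimes> a" if "a \<in> H" "b \<in> H" for a b
    using comm_monoid.m_comm[OF comm_group.axioms(1)[OF H(2)], of a b] that by simp
  ultimately have "abelian_normal_subgroup G N"
    using normal is_group
    by (intro abelian_normal_subgroup.intro abelian_normal_subgroup_axioms.intro) (auto simp: subset_eq)
  moreover have "finite (rcosets N)"
  proof -
    define act where "act g = (\<lambda>C\<in>rcosets H. C #> g)" for g
    have "act g \<in> rcosets H \<rightarrow>\<^sub>E rcosets H" if "g \<in> carrier G" for g
      using that HG by (auto simp: act_def RCOSETS_def coset_mult_assoc)
    then have "act ` carrier G \<subseteq> rcosets H \<rightarrow>\<^sub>E rcosets H" by blast
    then have "finite (act ` carrier G)" by (rule finite_subset) (simp add: finite_PiE H(3))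
    then have "finite ((\<lambda>a. N #> a) ` carrier G)"
    proof (rule finite_image_if_factors)
      fix a b assume ab: "a \<in> carrier G" "b \<in> carrier G" "act a = act b"
      have "g \<otimes> (a \<otimes> inv b) \<otimes> inv g \<in> H" if g: "g \<in> carrier G" for g
      proof -
        have "(H #> g) #> a = (H #> g) #> b"
          using fun_cong[OF ab(3), of "H #> g"] rcosetsI[OF HG g] by (simp add: act_def)
        then have "H #> (g \<otimes> a) = H #> (g \<otimes> b)"
          using ab g HG by (simp add: coset_mult_assoc)
        then have "H #> ((g \<otimes> a) \<otimes> inv (g \<otimes> b)) = H"
          using ab g HG by (intro coset_mult_inv2) simp_all
        then have "(g \<otimes> a) \<otimes> inv (g \<otimes> b) \<in> H"
          using ab g H(1) by (intro coset_join1[of H]) simp_all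
        then show ?thesis using ab g by (simp add: inv_mult_group m_assoc)
      qed
      then have "a \<otimes> inv b \<in> N" using ab by (simp add: N_def)
      then have "N #> (a \<otimes> inv b) = N"
        using ab \<open>subgroup N G\<close> by (intro coset_join2) simp_all
      then show "N #> a = N #> b"
        using ab subgroup.subset[OF \<open>subgroup N G\<close>] by (intro coset_mult_inv1) simp_all
    qed
    moreover have "rcosets N = (\<lambda>a. N #> a) ` carrier G" by (auto simp: RCOSETS_def)
    ultimately show ?thesis by simp
  qed
  ultimately show thesis by (rule that)
qed

section \<open>Adding products of sets of abelian letters\<close>

text \<open>
  \<open>Y\<close> is the set of all conjugates of the values in \<open>N\<close> of words over \<open>X\<close> of length at most the
  index of \<open>N\<close>. It is finite because an element of \<open>N\<close> has at most one conjugate for each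
  coset of \<open>N\<close>. The letters in \<open>A\<close> are the products of the nonempty subsets of \<open>Y\<close>; different
  subsets can have the same product, so the size of a letter is the maximal cardinality.
\<close>

lemma (in abelian_normal_subgroup) enlarge_generating_set:
  assumes index: "finite (rcosets N)" and X: "finite X" "generating_set G X"
  obtains A B :: "'a set" and sz m where "balanced_generators G N A B sz m" "X \<subseteq> A \<union> B"
proof -
  have XG: "X \<subseteq> carrier G" using X(2) by (simp add: generating_set_def)
  define m where "m = card (rcosets N)"
  define Y0 where "Y0 = wp ` {w \<in> lists X. length w \<le> m} \<inter> N"
  define Y where "Y = (\<Union>y\<in>Y0. (\<lambda>g. conj_by g y) ` carrier G)"
  have finY0: "finite Y0"
    unfolding Y0_def using finite_lists_length_le[OF X(1), of m]
    by (simp add: in_lists_conv_set subset_code(1))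
  have "finite ((\<lambda>g. conj_by g y) ` carrier G)" if y: "y \<in> N" for y
  proof (rule finite_image_if_factors[of "\<lambda>g. N #> g"])
    have "(\<lambda>g. N #> g) ` carrier G = rcosets N" by (auto simp: RCOSETS_def)
    then show "finite ((\<lambda>g. N #> g) ` carrier G)" using index by simp
    fix a b assume ab: "a \<in> carrier G" "b \<in> carrier G" "N #> a = N #> b"
    have n: "a \<otimes> inv b \<in> N"
      using coset_mult_inv2[OF ab(3,1,2) N_carrier] ab subgroup_N coset_join1[of N] by simp
    have "conj_by a y = conj_by ((a \<otimes> inv b) \<otimes> b) y" using ab by (simp add: m_assoc)
    also have "\<dots> = conj_by b (conj_by (a \<otimes> inv b) y)"
      using ab y n by (simp add: conj_by_conj_by)
    also have "conj_by (a \<otimes> inv b) y = y"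
    proof -
      define n where "n = a \<otimes> inv b"
      have "n \<in> N" using n by (simp add: n_def)
      then have "conj_by n y = inv n \<otimes> (n \<otimes> y)"
        using y by (simp add: conj_by_def commute[of y n] m_assoc)
      also have "\<dots> = y" using y \<open>n \<in> N\<close> by (simp add: m_assoc[symmetric])
      finally show ?thesis by (simp add: n_def)
    qed
    finally show "conj_by a y = conj_by b y" .
  qed
  then have finY: "finite Y" unfolding Y_def using finY0 by (auto simp: Y0_def)
  have Y0Y: "Y0 \<subseteq> Y"
  proof
    fix y assume y: "y \<in> Y0"
    then have "conj_by \<one> y = y" by (simp add: Y0_def)
    then show "y \<in> Y" unfolding Y_def using y by (metis UN_I imageI one_closed)
  qed
  have YN: "Y \<subseteq> N" unfolding Y_def Y0_def by auto
  have conjY: "conj_by g y \<in> Y" if y: "y \<in> Y" and g: "g \<in> carrier G" for g y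
  proof -
    obtain h z where "z \<in> Y0" "h \<in> carrier G" "y = conj_by h z" using y by (auto simp: Y_def)
    moreover from this have "conj_by g y = conj_by (h \<otimes> g) z"
      using g by (simp add: conj_by_conj_by Y0_def)
    ultimately show ?thesis unfolding Y_def using g by blast
  qed
  define prd where "prd S = val (mset_set S)" for S
  define P where "P = {S. S \<subseteq> Y \<and> S \<noteq> {}}"
  define A where "A = prd ` P"
  define deg where "deg a = Max (card ` {S \<in> P. prd S = a})" for a
  define sz where "sz a = (if a \<in> A then deg a else Suc (card Y))" for a
  define B where "B = X - N"
  have finP: "finite P" unfolding P_def using finY by simp
  have P: "finite S" "S \<subseteq> N" "set_mset (mset_set S) \<subseteq> N" if "S \<in> P" for S
    using that YN finite_subset[OF _ finY] by (auto simp: P_def)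
  have deg_ge: "card S \<le> deg (prd S)" if "S \<in> P" for S
    unfolding deg_def using that finP by (intro Max_ge) auto
  have deg_attained: "\<exists>S\<in>P. prd S = a \<and> card S = deg a" if "a \<in> A" for a
  proof -
    have "deg a \<in> card ` {S \<in> P. prd S = a}"
      unfolding deg_def using that finP by (intro Max_in) (auto simp: A_def)
    then show ?thesis by auto
  qed
  have deg_le: "deg a \<le> card Y" if "a \<in> A" for a
  proof -
    obtain S where "S \<subseteq> Y" "card S = deg a" using deg_attained[OF \<open>a \<in> A\<close>] by (auto simp: P_def)
    then show ?thesis using card_mono[OF finY] by metis
  qed
  have AN: "A \<subseteq> N" unfolding A_def prd_def using P(3) val_closed by blast
  have conjP: "conj_by g ` S \<in> P \<and> prd (conj_by g ` S) = conj_by g (prd S) \<and> card (conj_by g ` S) = card S"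
    if S: "S \<in> P" and g: "g \<in> carrier G" for S g
  proof -
    have inj: "inj_on (conj_by g) S"
      using inj_conj_by[OF g] by (rule inj_on_subset) (use P(2)[OF S] N_carrier in auto)
    have "prd (conj_by g ` S) = conj_by g (prd S)"
      unfolding prd_def image_mset_mset_set[OF inj, symmetric] using g P(3)[OF S] by (rule val_image_conj_by)
    moreover have "conj_by g ` S \<in> P" using S conjY g by (auto simp: P_def)
    ultimately show ?thesis using inj by (simp add: card_image)
  qed
  have conjA: "conj_by g a \<in> A" and deg_conj_le: "deg a \<le> deg (conj_by g a)"
    if a: "a \<in> A" and g: "g \<in> carrier G" for a g
  proof -
    obtain S where S: "S \<in> P" "prd S = a" "card S = deg a" using deg_attained[OF a] by blast
    then show "conj_by g a \<in> A" unfolding A_def using conjP[OF S(1) g] by (metis imageI)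
    show "deg a \<le> deg (conj_by g a)" using deg_ge conjP[OF S(1) g] S by metis
  qed
  have deg_conj: "deg (conj_by g a) = deg a" if a: "a \<in> A" and g: "g \<in> carrier G" for a g
  proof -
    have "conj_by (inv g) (conj_by g a) = a"
      using a g AN by (auto simp: conj_by_conj_by)
    then show ?thesis
      using deg_conj_le[OF a g] deg_conj_le[OF conjA[OF a g], of "inv g"] g by simp
  qed
  have Y0A: "y \<in> A" if "y \<in> Y0" for y
  proof -
    have "y \<in> Y" using that Y0Y by blast
    then have "{y} \<in> P" "prd {y} = y" using YN by (auto simp: P_def prd_def)
    then show ?thesis unfolding A_def by (metis imageI)
  qed
  have "rcosets N \<noteq> {}" using rcosetsI[OF N_carrier one_closed] by blast
  then have m_pos: "1 \<le> m" using index by (simp add: m_def Suc_le_eq card_gt_0_iff)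
  have XZ: "X \<subseteq> A \<union> B"
  proof
    fix x assume x: "x \<in> X"
    have "x \<in> Y0" if "x \<in> N"
    proof -
      have "x = wp [x]" using that by simp
      then show ?thesis using x m_pos that unfolding Y0_def by (intro IntI image_eqI[of _ _ "[x]"]) auto
    qed
    then show "x \<in> A \<union> B" using Y0A x by (auto simp: B_def)
  qed
  have "balanced_generators G N A B sz m"
  proof unfold_locales
    show "finite A" unfolding A_def using finP by simp
    show "A \<subseteq> N" by (rule AN)
    show "conj_by g a \<in> A" if "a \<in> A" "g \<in> carrier G" for a g using that by (rule conjA)
    show "sz (conj_by g a) = sz a" if "a \<in> A" "g \<in> carrier G" for a g
      using that conjA deg_conj by (simp add: sz_def)
    show "finite B" "B \<subseteq> carrier G" "B \<inter> N = {}" using X XG by (auto simp: B_def)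
    show "sz b = sz b'" if "b \<in> B" "b' \<in> B" for b b'
      using that AN by (auto simp: sz_def B_def)
    show "sz a < sz b" if "a \<in> A" "b \<in> B" for a b
      using that AN deg_le by (auto simp: sz_def B_def less_Suc_eq_le)
    show "generating_set G (A \<union> B)"
    proof -
      have "lists X \<subseteq> lists (A \<union> B)" using XZ by (rule lists_mono)
      then show ?thesis
        using X(2) AN N_carrier XG unfolding generating_set_def B_def by blast
    qed
    show "\<exists>s\<in>lists (A \<union> B). wp s = wp \<tau> \<and> length s < length \<tau>"
      if \<tau>: "\<tau> \<in> lists B" and long: "m \<le> length \<tau>" for \<tau>
    proof -
      have car: "set v \<subseteq> carrier G" if "set v \<subseteq> set \<tau>" for v
        using that \<tau> XG by (auto simp: B_def in_lists_conv_set)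
      define coset where "coset i = N #> wp (take i \<tau>)" for i
      have "coset ` {..m} \<subseteq> rcosets N"
        unfolding coset_def using rcosetsI[OF N_carrier] wp_closed[OF car[OF set_take_subset]] by blast
      then have "card (coset ` {..m}) \<le> m" using card_mono[OF index] by (simp add: m_def)
      then have "\<not> inj_on coset {..m}" by (intro pigeonhole) simp
      then obtain i' j' where "i' \<le> m" "j' \<le> m" "i' \<noteq> j'" "coset i' = coset j'"
        by (auto simp: inj_on_def)
      then have "\<exists>i j. i < j \<and> j \<le> m \<and> coset i = coset j" by (metis linorder_neqE_nat)
      then obtain i j where ij: "i < j" "j \<le> m" "coset i = coset j" by blast
      \<comment> \<open>The prefixes of length \<open>i\<close> and \<open>j\<close> lie in the same coset, so the
        subword \<open>s\<close> between them has its value in \<open>N\<close>.\<close>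
      define u s v where "u = take i \<tau>" and "s = take (j - i) (drop i \<tau>)" and "v = drop j \<tau>"
      have us: "take j \<tau> = u @ s" using ij(1) by (simp add: u_def s_def flip: take_add)
      then have split: "\<tau> = u @ s @ v" unfolding v_def by (metis append.assoc append_take_drop_id)
      then have carr: "set u \<subseteq> carrier G" "set s \<subseteq> carrier G" "set v \<subseteq> carrier G"
        using car[of u] car[of s] car[of v] by auto
      have len_s: "length s = j - i" using ij long by (simp add: s_def)
      have "N #> wp (u @ s) = N #> wp u" using ij(3) by (simp add: coset_def us u_def)
      then have "wp (u @ s) \<otimes> inv (wp u) \<in> N"
        using carr coset_mult_inv2[of N "wp (u @ s)" "wp u"] N_carrier subgroup_N
        by (intro coset_join1[of N]) simp_all
      then have "conj_by (wp u) (wp (u @ s) \<otimes> inv (wp u)) \<in> N" using carr by simp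
      then have sN: "wp s \<in> N"
        using carr by (simp add: conj_by_def wp_append m_assoc) (simp add: m_assoc[symmetric])
      have "s \<in> lists X" using \<tau> split by (auto simp: B_def in_lists_conv_set)
      then have "wp s \<in> Y0" using sN len_s ij(2) by (auto simp: Y0_def)
      then have sA: "wp s \<in> A" by (rule Y0A)
      \<comment> \<open>A subword of length one would be a letter outside \<open>N\<close>, so
        replacing \<open>s\<close> by one letter saves length.\<close>
      have "length s \<noteq> 1"
      proof
        assume "length s = 1"
        then obtain x where "s = [x]" by (auto simp: length_Suc_conv)
        then show False using sN \<tau> split carr by (auto simp: B_def)
      qed
      then have "1 < length s" using len_s ij(1) by simp
      then have "length (u @ wp s # v) < length \<tau>" using split by simp
      moreover have "wp (u @ wp s # v) = wp \<tau>"
        using split carr by (simp add: wp_append)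
      moreover have "u @ wp s # v \<in> lists (A \<union> B)"
        using \<tau> split sA by (auto simp: in_lists_conv_set)
      ultimately show ?thesis by blast
    qed
    show "\<exists>M. set_mset M \<subseteq> A \<and> val M = a \<otimes> b \<and> better (image_mset sz M) {#sz a, sz b#}"
      if a: "a \<in> A" and b: "b \<in> A" and ab: "a \<noteq> b" "sz a = sz b" for a b
    proof -
      obtain S T where S: "S \<in> P" "prd S = a" "card S = deg a" and T: "T \<in> P" "prd T = b" "card T = deg b"
        using deg_attained[OF a] deg_attained[OF b] by blast
      have eq: "card S = card T" "S \<noteq> T" using S T a b ab by (auto simp: sz_def)
      have fin: "finite S" "finite T" using P(1) S T by blast+
      have "\<not> T \<subseteq> S" using eq fin card_subset_eq[of S T] by auto
      then have "S \<subset> S \<union> T" by blast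
      then have bigger: "card S < card (S \<union> T)" using fin by (intro psubset_card_mono) simp
      have UP: "S \<union> T \<in> P" using S(1) T(1) by (auto simp: P_def)
      have UA: "prd (S \<union> T) \<in> A" unfolding A_def using UP by (rule imageI)
      have sz_U: "sz a < sz (prd (S \<union> T))"
        using bigger deg_ge[OF UP] S(3) a UA by (simp add: sz_def)
      \<comment> \<open>Uncrossing: the product is unchanged, and the union has a larger size than \<open>a\<close> and \<open>b\<close>.\<close>
      have "mset_set S + mset_set T = mset_set (S \<union> T) + mset_set (S \<inter> T)"
        using fin by (intro multiset_eqI) (auto simp: count_mset_set')
      moreover have sub: "set_mset (mset_set (S \<inter> T)) \<subseteq> N" using P(2)[OF S(1)] fin by auto
      ultimately have prod: "a \<otimes> b = prd (S \<union> T) \<otimes> prd (S \<inter> T)"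
        using val_add[OF P(3)[OF S(1)] P(3)[OF T(1)]] val_add[OF P(3)[OF UP] sub] S(2) T(2)
        by (simp add: prd_def)
      have UN: "prd (S \<union> T) \<in> N" using UA AN by blast
      show ?thesis
      proof (cases "S \<inter> T = {}")
        case True
        then have "a \<otimes> b = prd (S \<union> T)" using prod UN by (simp add: prd_def)
        then show ?thesis using UA UN by (intro exI[of _ "{#prd (S \<union> T)#}"]) (simp add: better_def)
      next
        case False
        then have IA: "prd (S \<inter> T) \<in> A" unfolding A_def using S(1) by (intro imageI) (auto simp: P_def)
        then have "val {#prd (S \<union> T), prd (S \<inter> T)#} = a \<otimes> b"
          using UN AN prod val_pair by auto
        then show ?thesis
          using UA IA better_pair[OF sz_U, of "sz (prd (S \<inter> T))"] ab(2)
          by (intro exI[of _ "{#prd (S \<union> T), prd (S \<inter> T)#}"]) simp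
      qed
    qed
  qed
  then show thesis using XZ by (rule that)
qed

section \<open>Virtually abelian groups\<close>

theorem proposition10p1:
  fixes G :: "('a, 'b) monoid_scheme" and X :: "'a set"
  assumes "group G"
    and "finitely_generated G"
    and "virtually_abelian G"
    and "finite X"
    and "generating_set G X"
  shows "\<exists>Z. X \<subseteq> Z \<and> finite Z \<and> generating_set G Z \<and>
           NSC G Z \<and> FFTP G Z \<and>
           (\<exists>L. biautomatic_structure G Z L \<and> geodesic_language G Z L \<and> prefix_closed L)"
proof -
  interpret group G by fact
  obtain H where "subgroup H G" "comm_group (G\<lparr>carrier := H\<rparr>)" "finite (rcosets\<^bsub>G\<^esub> H)"
    using assms(3) by (auto simp: virtually_abelian_def)
  then obtain N where N: "abelian_normal_subgroup G N" "finite (rcosets\<^bsub>G\<^esub> N)"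
    by (rule normal_core_of_abelian_subgroup)
  obtain A B sz m where Z: "balanced_generators G N A B sz m" and XZ: "X \<subseteq> A \<union> B"
    using abelian_normal_subgroup.enlarge_generating_set[OF N assms(4,5)] by blast
  interpret balanced_generators G N A B sz m by (rule Z)
  show ?thesis
    using XZ finite_Z generating NSC_Z FFTP_Z \<L>_biautomatic \<L>_geodesic \<L>_prefix_closed
    by blast
qed

end
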